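(* Let $d>k\geq1$, $\varepsilon\in(0,1)$, let $A\in\mathbb{R}^{d\times d}$ be symmetric positive semidefinite with $\lambda_k>\lambda_{k+1}$, and let $X_0\in\mathrm{St}(d,k)$ with $\cos\theta_k(U_k,X_0)>0$. Let $\beta>0$ satisfy $\lambda_{k+1}>2\sqrt\beta$. Consider the ANPM iterates $(X_t)_{t\geq0}$ with momentum $\beta$ and perturbations $(\Xi_t)_{t\geq 0}$ satisfying, for all $t\geq0$, $$\|U_{-k}^\top\Xi_t\|_2\leq c(\lambda_k-\lambda_{k+1})\varepsilon,\qquad \|U_k^\top\Xi_t\|_2\leq c(\lambda_k-\lambda_{k+1})\cos\theta_k(U_k,X_t),$$ with $c=1/32$. Then there is $T=O\!\left(\frac{\lambda_k^+}{\lambda_k^+-\lambda_{k+1}^+}\log\frac{\tan\theta_k(U_k,X_0)}{\varepsilon}\right)$ (with an absolute implied constant) such that $\sin\theta_k(U_k,X_t)\leq\varepsilon$ for all $t\geq T$.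
   Context: $A$ has eigenvalues $\lambda_1\geq\dots\geq\lambda_d\geq0$ with orthonormal eigenvectors $u_1,\dots,u_d$; $U_k:=[u_1,\dots,u_k]$, $U_{-k}:=[u_{k+1},\dots,u_d]$. For $x\geq 2\sqrt\beta$, $x^+:=\frac{x+\sqrt{x^2-4\beta}}{2}$. $\mathrm{St}(d,k):=\{X\in\mathbb{R}^{d\times k}:X^\top X=I_k\}$. $\mathrm{QR}(Y)=(X,R)$ with $Y=XR$, $X\in\mathrm{St}(d,k)$, $R$ upper triangular with nonnegative diagonal. $\theta_k(U,X):=\arccos\sigma_{\min}(U^\top X)$. ANPM: given $X_0$, $(X_1,R_1)=\mathrm{QR}(\tfrac12AX_0+\Xi_0)$, and for $t\geq1$, $Y_{t+1}=AX_t-\beta X_{t-1}R_t^{-1}+\Xi_t$, $(X_{t+1},R_{t+1})=\mathrm{QR}(Y_{t+1})$.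
   Formalization: In the bound on T the logarithm log(tan θ_k(U_k,X_0)/ε) is replaced by max(1, log(tan θ_k(U_k,X_0)/ε)), since the literal bound fails when tan θ_k(U_k,X_0) is below or barely above ε. *)

theory Defs
  imports Complex_Main "Jordan_Normal_Form.Matrix"
begin

definition vnorm :: "real vec \<Rightarrow> real" where
  "vnorm v = sqrt (v \<bullet> v)"

definition norm2 :: "real mat \<Rightarrow> real" where
  "norm2 M = Sup {vnorm (M *\<^sub>v x) | x. x \<in> carrier_vec (dim_col M) \<and> vnorm x = 1}"

text \<open>Smallest singular value (variational characterisation, columns count k \<ge> 1).\<close>
definition sigma_min :: "real mat \<Rightarrow> real" where
  "sigma_min M = Inf {vnorm (M *\<^sub>v x) | x. x \<in> carrier_vec (dim_col M) \<and> vnorm x = 1}"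

definition theta :: "real mat \<Rightarrow> real mat \<Rightarrow> real" where
  "theta U X = arccos (sigma_min (transpose_mat U * X))"

definition stiefel :: "nat \<Rightarrow> nat \<Rightarrow> real mat set" where
  "stiefel d k = {X. X \<in> carrier_mat d k \<and> transpose_mat X * X = 1\<^sub>m k}"

definition is_QR :: "nat \<Rightarrow> nat \<Rightarrow> real mat \<Rightarrow> real mat \<Rightarrow> real mat \<Rightarrow> bool" where
  "is_QR d k Y X R \<longleftrightarrow> X \<in> stiefel d k \<and> R \<in> carrier_mat k k \<and> upper_triangular R
     \<and> (\<forall>i<k. R $$ (i,i) \<ge> 0) \<and> Y = X * R"

definition plus_map :: "real \<Rightarrow> real \<Rightarrow> real" where
  "plus_map \<beta> x = (x + sqrt (x\<^sup>2 - 4 * \<beta>)) / 2"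

text \<open>U_k = [u_1..u_k] and U_{-k} = [u_{k+1}..u_d] (eigenvectors indexed from 1).\<close>
definition Utop :: "nat \<Rightarrow> nat \<Rightarrow> (nat \<Rightarrow> real vec) \<Rightarrow> real mat" where
  "Utop d k u = mat d k (\<lambda>(i,j). u (j+1) $ i)"

definition Ubot :: "nat \<Rightarrow> nat \<Rightarrow> (nat \<Rightarrow> real vec) \<Rightarrow> real mat" where
  "Ubot d k u = mat d (d-k) (\<lambda>(i,j). u (j+k+1) $ i)"

end

theory Submission
  imports Defs "HOL-Analysis.L2_Norm" "Jordan_Normal_Form.Determinant"
begin

text \<open>Fix a direction \<open>\<xi>\<close> in \<open>\<real>\<^sup>k\<close> and put \<open>z\<^sub>t = X\<^sub>t R\<^sub>t \<dots> R\<^sub>1 \<xi>\<close>.  Then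
  \<open>z\<^sub>t\<^sub>+\<^sub>1 = A z\<^sub>t - \<beta> z\<^sub>t\<^sub>-\<^sub>1 + noise\<close>, which decouples in the eigenbasis.  Let \<open>m\<^sub>t\<close> and \<open>n\<^sub>t\<close> be the norms
  of the top and bottom coordinates, and let \<open>P\<^sub>t(x)\<close> be the Chebyshev polynomial of the first kind
  scaled to solve the noiseless recursion, so that \<open>P\<^sub>t(x)\<close> grows like \<open>(x\<^sup>+)\<^sup>t\<close>.  The noise in the top
  coordinates is at most \<open>c \<delta> m\<^sub>t\<close>, with \<open>\<delta> = \<lambda>\<^sub>k - \<lambda>\<^sub>k\<^sub>+\<^sub>1\<close>, so \<open>m\<^sub>t\<close> grows at least like
  \<open>P\<^sub>t(\<lambda>\<^sub>k - \<delta>/16)\<close>.  The variation-of-constants formula for the bottom coordinates has nonnegative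
  kernel after replacing all eigenvalues by \<open>\<lambda>\<^sub>k\<^sub>+\<^sub>1\<close>, so \<open>n\<^sub>t\<close> is dominated by a scalar supersolution
  of the same recursion.  This gives
  \<open>n\<^sub>t / m\<^sub>t \<le> tan \<theta>\<^sub>0 P\<^sub>t(\<lambda>\<^sub>k\<^sub>+\<^sub>1 + \<delta>/16) / P\<^sub>t(\<lambda>\<^sub>k - \<delta>/16) + \<epsilon>/14\<close>; every unit vector of \<open>\<real>\<^sup>k\<close> is
  some \<open>R\<^sub>t \<dots> R\<^sub>1 \<xi>\<close>, so this bounds the tangent of the largest angle.\<close>

section \<open>Scaled Chebyshev polynomials as solutions of the momentum recursion\<close>

text \<open>The components are \<open>\<beta>\<^bsup>n/2\<^esup> T\<^sub>n(x / (2\<surd>\<beta>))\<close> and \<open>\<beta>\<^bsup>(n-1)/2\<^esup> U\<^sub>n\<^sub>-\<^sub>1(x / (2\<surd>\<beta>))\<close>, Chebyshev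
  polynomials of the first and second kind.\<close>
fun cheb :: "real \<Rightarrow> real \<Rightarrow> nat \<Rightarrow> real \<times> real" where
  "cheb \<beta> x 0 = (1, 0)"
| "cheb \<beta> x (Suc n) = (case cheb \<beta> x n of (p, s) \<Rightarrow>
     (x / 2 * p + (x\<^sup>2 / 4 - \<beta>) * s, p + x / 2 * s))"

definition chebP :: "real \<Rightarrow> real \<Rightarrow> nat \<Rightarrow> real" where
  "chebP \<beta> x n = fst (cheb \<beta> x n)"

definition chebS :: "real \<Rightarrow> real \<Rightarrow> nat \<Rightarrow> real" where
  "chebS \<beta> x n = snd (cheb \<beta> x n)"

lemma cheb_0 [simp]: "chebP \<beta> x 0 = 1" "chebS \<beta> x 0 = 0"
  by (simp_all add: chebP_def chebS_def)

lemma cheb_Suc: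
  "chebP \<beta> x (Suc n) = x / 2 * chebP \<beta> x n + (x\<^sup>2 / 4 - \<beta>) * chebS \<beta> x n"
  "chebS \<beta> x (Suc n) = chebP \<beta> x n + x / 2 * chebS \<beta> x n"
  by (simp_all add: chebP_def chebS_def case_prod_beta)

lemma cheb_1 [simp]: "chebP \<beta> x (Suc 0) = x / 2" "chebS \<beta> x (Suc 0) = 1"
  by (simp_all add: cheb_Suc)

lemma cheb_Suc_Suc:
  "chebP \<beta> x (Suc (Suc n)) = x * chebP \<beta> x (Suc n) - \<beta> * chebP \<beta> x n"
  "chebS \<beta> x (Suc (Suc n)) = x * chebS \<beta> x (Suc n) - \<beta> * chebS \<beta> x n"
  by (simp_all add: cheb_Suc field_simps power2_eq_square)

text \<open>Pell identity. With \<open>q = x\<^sup>2 / 4 - \<beta>\<close>, the pair encodes the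
  power \<open>(x / 2 + sqrt q) ^ n = p + s * sqrt q\<close>. The norm
  \<open>p\<^sup>2 - q * s\<^sup>2\<close> is multiplicative and equals \<beta> for
  \<open>n = 1\<close>.\<close>

lemma cheb_pell: "(chebP \<beta> x n)\<^sup>2 - (x\<^sup>2 / 4 - \<beta>) * (chebS \<beta> x n)\<^sup>2 = \<beta> ^ n"
proof (induction n)
  case (Suc n)
  have "(chebP \<beta> x (Suc n))\<^sup>2 - (x\<^sup>2 / 4 - \<beta>) * (chebS \<beta> x (Suc n))\<^sup>2
      = \<beta> * ((chebP \<beta> x n)\<^sup>2 - (x\<^sup>2 / 4 - \<beta>) * (chebS \<beta> x n)\<^sup>2)"
    unfolding cheb_Suc by (simp add: field_simps power2_eq_square)
  then show ?case using Suc by simp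
qed simp

lemma quarter_sq_ge:
  assumes "\<beta> \<ge> 0" "x \<ge> 2 * sqrt \<beta>"
  shows "x \<ge> 0" "x\<^sup>2 / 4 - \<beta> \<ge> 0"
proof -
  have 0: "0 \<le> 2 * sqrt \<beta>" using assms by simp
  then show "x \<ge> 0" using assms by linarith
  from power_mono[OF assms(2) 0, of 2] have "4 * \<beta> \<le> x\<^sup>2"
    using assms by (simp add: power_mult_distrib)
  then show "x\<^sup>2 / 4 - \<beta> \<ge> 0" by simp
qed

lemma chebP_sq_ge:
  assumes "\<beta> \<ge> 0" "x \<ge> 2 * sqrt \<beta>"
  shows "\<beta> ^ n \<le> (chebP \<beta> x n)\<^sup>2"
proof -
  have "0 \<le> (x\<^sup>2 / 4 - \<beta>) * (chebS \<beta> x n)\<^sup>2"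
    using quarter_sq_ge(2)[OF assms] by (intro mult_nonneg_nonneg) auto
  with cheb_pell[of \<beta> x n] show ?thesis by linarith
qed

text \<open>From \<open>2 * sqrt \<beta>\<close> on, all coefficients of the one-step form
  \<open>cheb_Suc\<close> are nonnegative and nondecreasing in \<open>x\<close>, so one induction
  gives everything. The three-term form has the negative coefficient \<open>- \<beta>\<close> and
  would not show it.\<close>

lemma cheb_mono:
  assumes b: "\<beta> \<ge> 0" and x: "x \<ge> 2 * sqrt \<beta>" and xy: "x \<le> y"
  shows "0 \<le> chebP \<beta> x n" "0 \<le> chebS \<beta> x n"
    "chebP \<beta> x n \<le> chebP \<beta> y n" "chebS \<beta> x n \<le> chebS \<beta> y n"
proof -
  note q = quarter_sq_ge[OF b x]
  have q2: "x\<^sup>2 / 4 - \<beta> \<le> y\<^sup>2 / 4 - \<beta>" using xy q(1) by (simp add: power_mono)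
  have "0 \<le> chebP \<beta> x n \<and> 0 \<le> chebS \<beta> x n \<and> chebP \<beta> x n \<le> chebP \<beta> y n
     \<and> chebS \<beta> x n \<le> chebS \<beta> y n"
  proof (induction n)
    case (Suc n)
    show ?case unfolding cheb_Suc
      using Suc q q2 xy by (intro conjI add_mono mult_mono add_nonneg_nonneg mult_nonneg_nonneg) linarith+
  qed simp
  then show "0 \<le> chebP \<beta> x n" "0 \<le> chebS \<beta> x n"
    "chebP \<beta> x n \<le> chebP \<beta> y n" "chebS \<beta> x n \<le> chebS \<beta> y n" by auto
qed

lemma cheb_pos:
  assumes "\<beta> > 0" "x \<ge> 2 * sqrt \<beta>"
  shows "0 < chebP \<beta> x n"
proof -
  have "0 < \<beta> ^ n" using assms by simp
  also have "\<beta> ^ n \<le> (chebP \<beta> x n)\<^sup>2" using chebP_sq_ge assms by simp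
  finally show ?thesis using cheb_mono(1)[of \<beta> x x n] assms by (simp add: less_le)
qed

text \<open>Lets a single parameter \<open>y\<close> dominate all smaller eigenvalues, including
  those below \<open>2 * sqrt \<beta>\<close>, where the polynomials oscillate and
  \<open>cheb_mono\<close> says nothing.\<close>

lemma cheb_abs_le:
  assumes b: "\<beta> > 0" and y: "y \<ge> 2 * sqrt \<beta>" and x0: "0 \<le> x" and xy: "x \<le> y"
  shows "\<bar>chebP \<beta> x n\<bar> \<le> chebP \<beta> y n" "\<bar>chebS \<beta> x n\<bar> \<le> chebS \<beta> y n"
proof -
  have "\<bar>chebP \<beta> x n\<bar> \<le> chebP \<beta> y n \<and> \<bar>chebS \<beta> x n\<bar> \<le> chebS \<beta> y n"
  proof (cases "x \<ge> 2 * sqrt \<beta>")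
    case True
    then show ?thesis using cheb_mono[of \<beta> x y n] b xy by auto
  next
    case False
    have "x\<^sup>2 \<le> (2 * sqrt \<beta>)\<^sup>2" using False x0 by (intro power_mono) auto
    then have q: "x\<^sup>2 / 4 - \<beta> \<le> 0" using b by (simp add: power_mult_distrib)
    \<comment> \<open>In the oscillating range the Pell identity bounds
      \<open>(chebP \<beta> x m)\<^sup>2\<close> above by \<open>\<beta> ^ m\<close>, and at
      \<open>y\<close> the same identity makes \<open>\<beta> ^ m\<close> a lower bound.\<close>
    have P: "\<bar>chebP \<beta> x m\<bar> \<le> chebP \<beta> y m" for m
    proof -
      have "(chebP \<beta> x m)\<^sup>2 \<le> \<beta> ^ m"
        using cheb_pell[of \<beta> x m] mult_nonpos_nonneg[OF q, of "(chebS \<beta> x m)\<^sup>2"] by simp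
      also have "\<beta> ^ m \<le> (chebP \<beta> y m)\<^sup>2"
        using chebP_sq_ge b y by simp
      finally show ?thesis using cheb_mono(1)[of \<beta> y y m] b y
        by (simp add: abs_le_square_iff[symmetric])
    qed
    \<comment> \<open>The second row of \<open>cheb_Suc\<close> does not contain
      \<open>x\<^sup>2 / 4 - \<beta>\<close>, the coefficient that is now nonpositive, so the bound
      on \<open>chebP\<close> carries over by induction.\<close>
    have "\<bar>chebS \<beta> x n\<bar> \<le> chebS \<beta> y n"
    proof (induction n)
      case (Suc n)
      have "\<bar>chebS \<beta> x (Suc n)\<bar> \<le> \<bar>chebP \<beta> x n\<bar> + x / 2 * \<bar>chebS \<beta> x n\<bar>"
        unfolding cheb_Suc using x0 by (simp add: abs_mult[symmetric] order.trans[OF abs_triangle_ineq] abs_mult)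
      also have "\<dots> \<le> chebP \<beta> y n + y / 2 * chebS \<beta> y n"
        using P[of n] Suc x0 xy by (intro add_mono mult_mono) auto
      finally show ?case unfolding cheb_Suc .
    qed simp
    with P show ?thesis by blast
  qed
  then show "\<bar>chebP \<beta> x n\<bar> \<le> chebP \<beta> y n" "\<bar>chebS \<beta> x n\<bar> \<le> chebS \<beta> y n" by auto
qed

text \<open>Variation of constants. \<open>chebP\<close> is the noiseless solution because the first
  step is halved (\<open>chebP\<close> starts with 1 and \<open>x / 2\<close>), and
  \<open>chebS\<close> is the response to a unit impulse.\<close>

lemma momentum_duhamel:
  fixes v f :: "nat \<Rightarrow> real"
  assumes v1: "v (Suc 0) = x / 2 * v 0 + f 0"
    and v2: "\<And>t. v (Suc (Suc t)) = x * v (Suc t) - \<beta> * v t + f (Suc t)"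
  shows "v t = chebP \<beta> x t * v 0 + (\<Sum>s<t. chebS \<beta> x (t - s) * f s)"
proof (induction t rule: induct_nat_012)
  case 1
  then show ?case using v1 by simp
next
  case (ge2 n)
  have S: "(\<Sum>s<n. chebS \<beta> x (Suc (Suc n) - s) * f s)
      = x * (\<Sum>s<n. chebS \<beta> x (Suc n - s) * f s) - \<beta> * (\<Sum>s<n. chebS \<beta> x (n - s) * f s)"
  proof -
    have "(\<Sum>s<n. chebS \<beta> x (Suc (Suc n) - s) * f s)
        = (\<Sum>s<n. x * (chebS \<beta> x (Suc n - s) * f s) - \<beta> * (chebS \<beta> x (n - s) * f s))"
    proof (intro sum.cong refl)
      fix s assume "s \<in> {..<n}"
      then have "Suc (Suc n) - s = Suc (Suc (n - s))" "Suc n - s = Suc (n - s)" by auto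
      then show "chebS \<beta> x (Suc (Suc n) - s) * f s
          = x * (chebS \<beta> x (Suc n - s) * f s) - \<beta> * (chebS \<beta> x (n - s) * f s)"
        by (simp add: cheb_Suc_Suc left_diff_distrib mult.assoc)
    qed
    then show ?thesis by (simp add: sum_subtractf sum_distrib_left)
  qed
  \<comment> \<open>The two newest impulses have lags 2 and 1, where \<open>chebS\<close> takes the
    values \<open>x\<close> and 1.\<close>
  have "(\<Sum>s<Suc (Suc n). chebS \<beta> x (Suc (Suc n) - s) * f s)
      = (\<Sum>s<n. chebS \<beta> x (Suc (Suc n) - s) * f s) + x * f n + f (Suc n)"
    using cheb_Suc_Suc(2)[of \<beta> x 0] by (simp add: numeral_2_eq_2)
  moreover have "(\<Sum>s<Suc n. chebS \<beta> x (Suc n - s) * f s)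
      = (\<Sum>s<n. chebS \<beta> x (Suc n - s) * f s) + f n"
    by simp
  ultimately show ?case
    unfolding v2 ge2 S cheb_Suc_Suc(1) by (simp only: ring_distribs)
qed simp

section \<open>Growth rate \<open>plus_map\<close> and decay of Chebyshev ratios\<close>

text \<open>\<open>chebP\<close> is the mean of the n-th powers of the roots
  \<open>x / 2 + D\<close> and \<open>x / 2 - D\<close> of
  \<open>r\<^sup>2 - x * r + \<beta>\<close>. The larger root is \<open>plus_map \<beta> x\<close>;
  the smaller one lies between 0 and it.\<close>

lemma cheb_plus_map:
  assumes "\<beta> \<ge> 0" "x \<ge> 2 * sqrt \<beta>"
  shows "chebP \<beta> x n \<le> plus_map \<beta> x ^ n" "plus_map \<beta> x ^ n \<le> 2 * chebP \<beta> x n"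
proof -
  define D where "D = sqrt (x\<^sup>2 - 4 * \<beta>) / 2"
  note q = quarter_sq_ge[OF assms]
  have D0: "D \<ge> 0" and D2: "D\<^sup>2 = x\<^sup>2 / 4 - \<beta>"
    using q by (auto simp: D_def power_divide)
  have pm: "plus_map \<beta> x = x / 2 + D" by (simp add: plus_map_def D_def field_simps)
  have pow: "(x / 2 + c) ^ n = chebP \<beta> x n + c * chebS \<beta> x n" if c: "c\<^sup>2 = x\<^sup>2 / 4 - \<beta>" for c
  proof (induction n)
    case (Suc n)
    have "(x / 2 + c) ^ Suc n = (x / 2 + c) * (chebP \<beta> x n + c * chebS \<beta> x n)"
      using Suc by simp
    also have "\<dots> = chebP \<beta> x (Suc n) + c * chebS \<beta> x (Suc n)"
      unfolding cheb_Suc c[symmetric] by (simp add: algebra_simps power2_eq_square)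
    finally show ?case .
  qed simp
  have "(x / 2 + D) ^ n = chebP \<beta> x n + D * chebS \<beta> x n"
    by (rule pow[OF D2])
  moreover have "(x / 2 - D) ^ n = chebP \<beta> x n - D * chebS \<beta> x n"
    using pow[of "- D"] by (simp add: D2)
  moreover have "D\<^sup>2 \<le> (x / 2)\<^sup>2"
    unfolding D2 using assms(1) by (simp add: power_divide)
  then have "D \<le> x / 2" by (rule power2_le_imp_le) (use q in simp)
  then have "(x / 2 - D) ^ n \<ge> 0" by simp
  moreover have "D * chebS \<beta> x n \<ge> 0" using D0 cheb_mono(2)[of \<beta> x x n] assms by simp
  ultimately show "chebP \<beta> x n \<le> plus_map \<beta> x ^ n" "plus_map \<beta> x ^ n \<le> 2 * chebP \<beta> x n"
    unfolding pm by linarith+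
qed

text \<open>With \<open>g z = sqrt (z\<^sup>2 - 4 * \<beta>)\<close>, the increment of \<open>g\<^sup>2\<close> over the middle part is exactly \<open>7/8\<close> of
  its increment over \<open>[x, y]\<close>, since both cut-off ends have length \<open>(y - x)/16\<close>; dividing by
  the sum of the two end values of \<open>g\<close> costs at most another factor \<open>2\<close>.\<close>
lemma plus_map_middle_gap:
  assumes b: "\<beta> \<ge> 0" and x: "x \<ge> 2 * sqrt \<beta>" and xy: "x < y"
  shows "7 / 16 * (plus_map \<beta> y - plus_map \<beta> x)
    \<le> plus_map \<beta> (y - (y - x) / 16) - plus_map \<beta> (x + (y - x) / 16)"
proof -
  define g where "g z = sqrt (z\<^sup>2 - 4 * \<beta>)" for z
  define x' y' where "x' = x + (y - x) / 16" and "y' = y - (y - x) / 16"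
  have ord: "x \<le> x'" "x' < y'" "y' \<le> y" using xy by (auto simp: x'_def y'_def field_simps)
  have g2: "(g z)\<^sup>2 = z\<^sup>2 - 4 * \<beta>" and g0: "g z \<ge> 0" if "z \<ge> x" for z
    using quarter_sq_ge[of \<beta> z] b x that by (auto simp: g_def)
  have gm: "g z \<le> g w" if "x \<le> z" "z \<le> w" for z w
    using that quarter_sq_ge(1)[OF b x] by (simp add: g_def power_mono)
  have gpos: "g y > 0"
    using quarter_sq_ge[OF b x] xy power_strict_mono[of x y 2] by (simp add: g_def)
  have pm: "plus_map \<beta> z = (z + g z) / 2" for z
    by (simp add: plus_map_def g_def)
  have eq: "(g y' - g x') * (g y' + g x') = 7 / 8 * ((g y - g x) * (g y + g x))"
  proof -
    have "(g y' - g x') * (g y' + g x') = (g y')\<^sup>2 - (g x')\<^sup>2" by (simp add: power2_eq_square algebra_simps)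
    also have "\<dots> = y'\<^sup>2 - x'\<^sup>2" using ord xy by (simp add: g2)
    also have "\<dots> = 7 / 8 * (y\<^sup>2 - x\<^sup>2)" by (simp add: x'_def y'_def field_simps power2_eq_square)
    also have "\<dots> = 7 / 8 * ((g y)\<^sup>2 - (g x)\<^sup>2)" using xy by (simp add: g2)
    finally show ?thesis by (simp add: power2_eq_square algebra_simps)
  qed
  have "7 / 16 * (g y - g x) \<le> g y' - g x'"
  proof -
    have "(g y - g x) * g y \<le> (g y - g x) * (g y + g x)"
      using g0[of x] gm[of x y] xy by (intro mult_left_mono) auto
    moreover have "7 / 16 * (g y - g x) * (2 * g y) = 7 / 8 * ((g y - g x) * g y)" by simp
    ultimately have "7 / 16 * (g y - g x) * (2 * g y) \<le> 7 / 8 * ((g y - g x) * (g y + g x))"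
      by linarith
    also have "\<dots> \<le> (g y' - g x') * (2 * g y)"
      unfolding eq[symmetric] using gm[of x' y'] gm[of y' y] gm[of x' y] ord
      by (intro mult_left_mono) auto
    finally show ?thesis by (rule mult_right_le_imp_le) (use gpos in simp)
  qed
  moreover have "7 / 16 * (y - x) \<le> y' - x'"
    using xy by (simp add: x'_def y'_def field_simps)
  ultimately have "7 / 16 * (y - x) + 7 / 16 * (g y - g x) \<le> (y' - x') + (g y' - g x')"
    by (rule add_mono[rotated])
  then have "(7 / 16 * (y - x) + 7 / 16 * (g y - g x)) / 2 \<le> ((y' - x') + (g y' - g x')) / 2"
    by (rule divide_right_mono) simp
  moreover have "7 / 16 * (plus_map \<beta> y - plus_map \<beta> x) = (7 / 16 * (y - x) + 7 / 16 * (g y - g x)) / 2"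
    by (simp add: pm field_simps)
  moreover have "plus_map \<beta> y' - plus_map \<beta> x' = ((y' - x') + (g y' - g x')) / 2"
    by (simp add: pm field_simps)
  ultimately have "7 / 16 * (plus_map \<beta> y - plus_map \<beta> x) \<le> plus_map \<beta> y' - plus_map \<beta> x'"
    by metis
  then show ?thesis by (simp only: x'_def y'_def)
qed

lemma plus_map_mono:
  assumes "\<beta> \<ge> 0" "x \<ge> 2 * sqrt \<beta>" "x \<le> y"
  shows "plus_map \<beta> x \<le> plus_map \<beta> y"
  using quarter_sq_ge(1)[OF assms(1,2)] assms by (simp add: plus_map_def power_mono add_mono)

lemma plus_map_pos:
  assumes "\<beta> \<ge> 0" "x \<ge> 2 * sqrt \<beta>" "x > 0"
  shows "plus_map \<beta> x > 0"
  using quarter_sq_ge[OF assms(1,2)] assms by (simp add: plus_map_def add_pos_nonneg)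

text \<open>Passing from \<open>chebP\<close> to powers of \<open>plus_map\<close> costs the factor
  2. The relative gap of \<open>plus_map\<close> between the two shifted points is at least
  \<open>7 / 16 * \<rho>\<close>, and \<open>1 - s\<close> is at most
  \<open>exp (- s)\<close>.\<close>

lemma cheb_ratio_le:
  assumes b: "\<beta> > 0" and x: "x \<ge> 2 * sqrt \<beta>" and xy: "x < y"
  defines "\<rho> \<equiv> (plus_map \<beta> y - plus_map \<beta> x) / plus_map \<beta> y"
  shows "chebP \<beta> (x + (y - x) / 16) n / chebP \<beta> (y - (y - x) / 16) n
    \<le> 2 * exp (- (7 / 16 * \<rho> * real n))"
proof -
  define x' y' where "x' = x + (y - x) / 16" and "y' = y - (y - x) / 16"
  have ord: "x \<le> x'" "x' < y'" "y' \<le> y" using xy by (auto simp: x'_def y'_def field_simps)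
  have x0: "0 < x" using b x real_sqrt_gt_zero[OF b] by linarith
  let ?p = "plus_map \<beta>"
  have pp: "?p z > 0" if "z \<ge> x" for z using plus_map_pos[of \<beta> z] b x x0 that by auto
  have gap: "7 / 16 * (?p y - ?p x) \<le> ?p y' - ?p x'"
    using plus_map_middle_gap[of \<beta> x y] b x xy by (simp add: x'_def y'_def)
  have "?p x' / ?p y' = 1 - (?p y' - ?p x') / ?p y'"
    using pp[of y'] ord by (simp add: field_simps)
  also have "\<dots> \<le> 1 - 7 / 16 * (?p y - ?p x) / ?p y'"
    using gap pp[of y'] ord by (intro diff_left_mono divide_right_mono) auto
  also have "\<dots> \<le> 1 - 7 / 16 * (?p y - ?p x) / ?p y"
    using plus_map_mono[of \<beta> x y] plus_map_mono[of \<beta> y' y] pp[of y'] pp[of y] ord b x xy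
    by (intro diff_left_mono divide_left_mono mult_nonneg_nonneg mult_pos_pos) auto
  also have "\<dots> = 1 + - (7 / 16 * \<rho>)" by (simp add: \<rho>_def)
  also have "\<dots> \<le> exp (- (7 / 16 * \<rho>))" by (rule exp_ge_add_one_self)
  finally have r: "?p x' / ?p y' \<le> exp (- (7 / 16 * \<rho>))" .
  have "chebP \<beta> x' n / chebP \<beta> y' n \<le> ?p x' ^ n / (?p y' ^ n / 2)"
    using cheb_plus_map[of \<beta> x' n] cheb_plus_map[of \<beta> y' n] pp[of x'] pp[of y'] ord b x
    by (intro frac_le) auto
  also have "\<dots> = 2 * (?p x' / ?p y') ^ n" by (simp add: power_divide)
  also have "\<dots> \<le> 2 * exp (- (7 / 16 * \<rho>)) ^ n"
    using r pp[of x'] pp[of y'] ord by (intro mult_left_mono power_mono) auto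
  also have "\<dots> = 2 * exp (- (7 / 16 * \<rho> * real n))"
    by (simp add: exp_of_nat_mult[symmetric] mult_ac)
  finally show ?thesis by (simp add: x'_def y'_def)
qed

section \<open>Norms of the top and bottom coordinates under the noisy recursion\<close>

lemma L2_set_abs_mono:
  assumes "\<And>i. i \<in> K \<Longrightarrow> \<bar>f i\<bar> \<le> \<bar>g i\<bar>"
  shows "L2_set f K \<le> L2_set g K"
  unfolding L2_set_def
  by (intro real_sqrt_le_mono sum_mono) (simp add: assms abs_le_square_iff[symmetric])

lemma L2_set_diff_ge: "L2_set f K - L2_set g K \<le> L2_set (\<lambda>i. f i - g i) K"
  using L2_set_triangle_ineq[of "\<lambda>i. f i - g i" g K] by simp

lemma L2_set_uminus: "L2_set (\<lambda>i. - f i) K = L2_set f K"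
  by (simp add: L2_set_def)

lemma L2_set_sum_le: "finite T \<Longrightarrow> L2_set (\<lambda>i. \<Sum>s\<in>T. f s i) K \<le> (\<Sum>s\<in>T. L2_set (f s) K)"
proof (induction T rule: finite_induct)
  case (insert s T)
  then show ?case
    using L2_set_triangle_ineq[of "f s" "\<lambda>i. \<Sum>s\<in>T. f s i" K] by simp
qed (simp add: L2_set_def)

lemma L2_set_smult: "c \<ge> 0 \<Longrightarrow> L2_set (\<lambda>i. c * f i) K = c * L2_set f K"
  by (simp add: L2_set_right_distrib)

text \<open>By the reverse triangle inequality the norms satisfy the recursion with parameter \<mu>
  as an inequality. The slack is \<open>2 * \<eta>\<close> because the first step halves the
  eigenvalue but not the noise: \<open>l / 2 - \<eta>\<close> must reach
  \<open>\<mu> / 2\<close>.\<close>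

lemma dominant_growth:
  fixes a e :: "nat \<Rightarrow> nat \<Rightarrow> real"
  assumes b: "\<beta> > 0" and mu: "\<mu> \<ge> 2 * sqrt \<beta>" and \<eta>: "\<eta> \<ge> 0" "\<mu> + 2 * \<eta> \<le> l"
    and lam: "\<And>i. i \<in> K \<Longrightarrow> l \<le> lam i"
    and a1: "\<And>i. i \<in> K \<Longrightarrow> a (Suc 0) i = lam i / 2 * a 0 i + e 0 i"
    and a2: "\<And>t i. i \<in> K \<Longrightarrow> a (Suc (Suc t)) i = lam i * a (Suc t) i - \<beta> * a t i + e (Suc t) i"
    and noise: "\<And>t. L2_set (e t) K \<le> \<eta> * L2_set (a t) K"
    and pos: "L2_set (a 0) K > 0"
  shows "L2_set (a t) K > 0"
    and "s \<le> t \<Longrightarrow> L2_set (a s) K * chebP \<beta> \<mu> t \<le> L2_set (a t) K * chebP \<beta> \<mu> s"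
proof -
  define m where "m t = L2_set (a t) K" for t
  let ?P = "chebP \<beta> \<mu>"
  have P: "?P t > 0" for t using cheb_pos b mu by blast
  have mu0: "\<mu> \<ge> 0" using quarter_sq_ge(1)[OF less_imp_le[OF b] mu] .
  have l0: "l \<ge> 0" using mu0 \<eta> by linarith
  have big: "c * l * m t \<le> L2_set (\<lambda>i. c * lam i * a t i) K" if "c \<ge> 0" for c t
  proof -
    have "c * l * m t = L2_set (\<lambda>i. c * l * a t i) K"
      unfolding m_def using that l0 by (simp add: L2_set_smult)
    also have "\<dots> \<le> L2_set (\<lambda>i. c * lam i * a t i) K"
      using lam l0 that by (intro L2_set_abs_mono) (fastforce simp: abs_mult intro!: mult_right_mono mult_left_mono)
    finally show ?thesis .
  qed
  have m1: "m (Suc 0) \<ge> \<mu> / 2 * m 0"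
  proof -
    have "L2_set (a (Suc 0)) K = L2_set (\<lambda>i. 1 / 2 * lam i * a 0 i - (- e 0 i)) K"
      by (intro L2_set_cong) (auto simp: a1)
    then have "m (Suc 0) \<ge> 1 / 2 * l * m 0 - \<eta> * m 0"
      using L2_set_diff_ge[of "\<lambda>i. 1 / 2 * lam i * a 0 i" K "\<lambda>i. - e 0 i"] big[of "1 / 2" 0] noise[of 0]
      by (simp add: m_def L2_set_uminus)
    moreover have "\<mu> / 2 * m 0 \<le> (1 / 2 * l - \<eta>) * m 0"
      using \<eta> by (intro mult_right_mono) (auto simp: m_def)
    ultimately show ?thesis by (simp add: algebra_simps)
  qed
  have m2: "m (Suc (Suc t)) \<ge> \<mu> * m (Suc t) - \<beta> * m t" for t
  proof -
    have "L2_set (a (Suc (Suc t))) K = L2_set (\<lambda>i. 1 * lam i * a (Suc t) i - (\<beta> * a t i - e (Suc t) i)) K"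
      by (intro L2_set_cong) (auto simp: a2)
    moreover have "L2_set (\<lambda>i. \<beta> * a t i - e (Suc t) i) K \<le> \<beta> * m t + \<eta> * m (Suc t)"
      using L2_set_triangle_ineq[of "\<lambda>i. \<beta> * a t i" "\<lambda>i. - e (Suc t) i" K] noise[of "Suc t"] b
      by (simp add: m_def L2_set_uminus L2_set_smult)
    ultimately have "m (Suc (Suc t)) \<ge> l * m (Suc t) - (\<beta> * m t + \<eta> * m (Suc t))"
      using L2_set_diff_ge[of "\<lambda>i. 1 * lam i * a (Suc t) i" K "\<lambda>i. \<beta> * a t i - e (Suc t) i"] big[of 1 "Suc t"]
      by (simp add: m_def)
    moreover have "\<mu> * m (Suc t) \<le> (l - \<eta>) * m (Suc t)"
      using \<eta> by (intro mult_right_mono) (auto simp: m_def)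
    ultimately show ?thesis by (simp add: algebra_simps)
  qed
  \<comment> \<open>Monotonicity of \<open>m t / ?P t\<close>, cross-multiplied. A lower bound on
    \<open>m t\<close> alone would not propagate, since \<open>\<beta> * m t\<close> is subtracted;
    the ratio form bounds \<open>m t\<close> above by \<open>m (Suc t)\<close>.\<close>
  have step: "m t > 0 \<and> m t * ?P (Suc t) \<le> m (Suc t) * ?P t" for t
  proof (induction t)
    case 0
    then show ?case using pos m1 by (simp add: m_def mult.commute)
  next
    case (Suc t)
    then have "0 < m t * ?P (Suc t)" using P by simp
    with Suc have "0 < m (Suc t) * ?P t" by linarith
    with P have pos: "m (Suc t) > 0" by (simp add: zero_less_mult_iff not_less_iff_gr_or_eq) (metis P less_asym)
    have "m (Suc t) * ?P (Suc (Suc t)) = \<mu> * m (Suc t) * ?P (Suc t) - \<beta> * (m (Suc t) * ?P t)"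
      by (simp add: cheb_Suc_Suc algebra_simps)
    also have "\<dots> \<le> \<mu> * m (Suc t) * ?P (Suc t) - \<beta> * (m t * ?P (Suc t))"
      using Suc b by simp
    also have "\<dots> = (\<mu> * m (Suc t) - \<beta> * m t) * ?P (Suc t)" by (simp add: algebra_simps)
    also have "\<dots> \<le> m (Suc (Suc t)) * ?P (Suc t)"
      using m2 P[of "Suc t"] by (intro mult_right_mono) auto
    finally show ?case using pos by simp
  qed
  then show "L2_set (a t) K > 0" by (simp add: m_def)
  have "m s / ?P s \<le> m t / ?P t" if "s \<le> t"
    by (rule lift_Suc_mono_le[OF _ that]) (use step P in \<open>simp add: field_simps\<close>)
  then show "s \<le> t \<Longrightarrow> L2_set (a s) K * ?P t \<le> L2_set (a t) K * ?P s"
    using P[of s] P[of t] by (simp add: m_def field_simps)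
qed

text \<open>\<open>momentum_duhamel\<close> in each coordinate, then the triangle inequality over
  time. By \<open>cheb_abs_le\<close> every kernel is dominated by the one at \<open>L\<close>,
  which leaves scalar weights on the norms.\<close>

lemma recessive_bound:
  fixes v f :: "nat \<Rightarrow> nat \<Rightarrow> real"
  assumes b: "\<beta> > 0" and L: "L \<ge> 2 * sqrt \<beta>"
    and lam: "\<And>i. i \<in> J \<Longrightarrow> 0 \<le> lam i \<and> lam i \<le> L"
    and v1: "\<And>i. i \<in> J \<Longrightarrow> v (Suc 0) i = lam i / 2 * v 0 i + f 0 i"
    and v2: "\<And>t i. i \<in> J \<Longrightarrow> v (Suc (Suc t)) i = lam i * v (Suc t) i - \<beta> * v t i + f (Suc t) i"
  shows "L2_set (v t) J \<le> chebP \<beta> L t * L2_set (v 0) J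
    + (\<Sum>s<t. chebS \<beta> L (t - s) * L2_set (f s) J)"
proof -
  have P0: "0 \<le> chebP \<beta> L n" "0 \<le> chebS \<beta> L n" for n using cheb_mono[of \<beta> L L n] b L by auto
  have "L2_set (v t) J = L2_set (\<lambda>i. chebP \<beta> (lam i) t * v 0 i + (\<Sum>s<t. chebS \<beta> (lam i) (t - s) * f s i)) J"
    by (intro L2_set_cong refl momentum_duhamel[where v = "\<lambda>t. v t i" and f = "\<lambda>t. f t i" for i] v1 v2)
  also have "\<dots> \<le> L2_set (\<lambda>i. chebP \<beta> (lam i) t * v 0 i) J
      + (\<Sum>s<t. L2_set (\<lambda>i. chebS \<beta> (lam i) (t - s) * f s i) J)"
    by (intro order.trans[OF L2_set_triangle_ineq] add_left_mono L2_set_sum_le) simp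
  also have "\<dots> \<le> L2_set (\<lambda>i. chebP \<beta> L t * v 0 i) J
      + (\<Sum>s<t. L2_set (\<lambda>i. chebS \<beta> L (t - s) * f s i) J)"
    using cheb_abs_le[OF b L] lam
    by (intro add_mono sum_mono L2_set_abs_mono) (auto simp: abs_mult P0 intro!: mult_right_mono)
  finally show ?thesis by (simp add: L2_set_smult P0)
qed

lemma recessive_dominant_ratio:
  fixes a e :: "nat \<Rightarrow> nat \<Rightarrow> real"
  assumes b: "\<beta> > 0" and L: "L \<ge> 2 * sqrt \<beta>" and L0: "L < l" and eps: "0 < \<epsilon>" "\<epsilon> \<le> 1"
    and lamK: "\<And>i. i \<in> K \<Longrightarrow> l \<le> lam i"
    and lamJ: "\<And>i. i \<in> J \<Longrightarrow> 0 \<le> lam i \<and> lam i \<le> L"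
    and a1: "\<And>i. i \<in> K \<union> J \<Longrightarrow> a (Suc 0) i = lam i / 2 * a 0 i + e 0 i"
    and a2: "\<And>t i. i \<in> K \<union> J \<Longrightarrow> a (Suc (Suc t)) i = lam i * a (Suc t) i - \<beta> * a t i + e (Suc t) i"
    and noiseK: "\<And>t. L2_set (e t) K \<le> 1 / 32 * (l - L) * L2_set (a t) K"
    and noiseJ: "\<And>t. L2_set (e t) J \<le> 1 / 32 * (l - L) * \<epsilon> * (L2_set (a t) K + L2_set (a t) J)"
    and pos: "L2_set (a 0) K > 0" and h0: "h \<ge> 0" and h: "L2_set (a 0) J \<le> h * L2_set (a 0) K"
  shows "L2_set (a t) J \<le> (h * (chebP \<beta> (L + (l - L) / 16) t / chebP \<beta> (l - (l - L) / 16) t) + \<epsilon> / 14)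
    * L2_set (a t) K"
proof -
  define \<delta> where "\<delta> = l - L"
  \<comment> \<open>The shift \<open>\<delta> / 16\<close> is \<open>2 * \<eta>\<close> for the
    noise level \<open>\<eta> = \<delta> / 32\<close> in \<open>dominant_growth\<close>.\<close>
  define \<mu> where "\<mu> = l - \<delta> / 16"
  define L' where "L' = L + \<delta> / 16"
  define m n where "m t = L2_set (a t) K" and "n t = L2_set (a t) J" for t
  have d: "\<delta> > 0" using L0 by (simp add: \<delta>_def)
  have ord: "L \<le> L'" "L' \<le> \<mu>" "\<mu> \<le> l" using d by (auto simp: L'_def \<mu>_def \<delta>_def field_simps)
  let ?b = "chebP \<beta> \<mu>"
  let ?c = "1 / 32 * \<delta> * \<epsilon>"
  have c0: "?c \<ge> 0" using d eps by simp
  have bpos: "?b t > 0" for t using cheb_pos[of \<beta> \<mu> t] b L ord by simp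
  have ppos: "chebP \<beta> L' t > 0" for t using cheb_pos[of \<beta> L' t] b L ord by simp
  have Sn: "chebS \<beta> L n \<ge> 0" for n using cheb_mono(2)[of \<beta> L L n] b L by simp
  have growth: "m t > 0" "s \<le> t \<Longrightarrow> m s * ?b t \<le> m t * ?b s" for s t
    unfolding m_def
    using dominant_growth[of \<beta> \<mu> "1 / 32 * \<delta>" l K lam a e] b L ord d lamK a1 a2 noiseK pos
    by (auto simp: \<delta>_def \<mu>_def)
  \<comment> \<open>A supersolution: on \<open>chebP \<beta> L'\<close> and on \<open>chebP \<beta> \<mu>\<close> the recursion with parameter \<open>L\<close> leaves the
    residuals \<open>L' - L\<close> and \<open>\<mu> - L\<close>, and the weight \<open>\<epsilon>/14\<close> makes them pay for the noise.\<close>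
  define w where "w t = h * chebP \<beta> L' t + \<epsilon> / 14 * ?b t" for t
  define F where "F t = (if t = 0 then h * (L' - L) / 2 + \<epsilon> / 14 * (\<mu> - L) / 2
      else h * (L' - L) * chebP \<beta> L' t + \<epsilon> / 14 * (\<mu> - L) * ?b t)" for t
  have w: "w t = chebP \<beta> L t * w 0 + (\<Sum>s<t. chebS \<beta> L (t - s) * F s)" for t
    by (rule momentum_duhamel) (auto simp: w_def F_def cheb_Suc_Suc field_simps)
  \<comment> \<open>Half of each residual suffices, which covers the halved first step
    \<open>F 0\<close>. For the \<open>L'\<close> part, \<open>1 / 32\<close> is half of
    \<open>1 / 16\<close>. For the \<mu> part, the weight \<open>1 / 14\<close> solves
    \<open>1 / 32 * (1 + w) = w * (15 / 16) / 2\<close>.\<close>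
  have F: "F t \<ge> ?c * (?b t + w t)" for t
  proof -
    have gaps: "L' - L = \<delta> / 16" "\<mu> - L = 15 / 16 * \<delta>" by (auto simp: L'_def \<mu>_def \<delta>_def field_simps)
    have "?c * (h * chebP \<beta> L' t) \<le> 1 / 32 * \<delta> * (h * chebP \<beta> L' t)"
      using d eps h0 ppos[of t] by (intro mult_right_mono) auto
    moreover have "?c * (1 + \<epsilon> / 14) \<le> ?c * (15 / 14)"
      using c0 eps by (intro mult_left_mono) auto
    from mult_right_mono[OF this, of "?b t"] bpos[of t]
    have "?c * (?b t + \<epsilon> / 14 * ?b t) \<le> 1 / 32 * 15 / 14 * \<delta> * \<epsilon> * ?b t"
      by (simp add: algebra_simps)
    ultimately have "?c * (?b t + w t) \<le> h * (\<delta> / 16) * chebP \<beta> L' t / 2 + \<epsilon> / 14 * (15 / 16 * \<delta>) * ?b t / 2"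
      by (simp add: w_def algebra_simps)
    also have "\<dots> \<le> F t"
      unfolding F_def gaps using h0 d eps ppos[of t] bpos[of t] by (auto intro!: add_mono)
    finally show ?thesis .
  qed
  \<comment> \<open>The bound of \<open>n t / m t\<close> by \<open>w t / ?b t\<close>,
    cross-multiplied. Strong induction is needed because the noise at each \<open>s < t\<close>
    involves \<open>n s\<close>.\<close>
  have main: "n t * ?b t \<le> m t * w t" for t
  proof (induction t rule: less_induct)
    case (less t)
    have "n t \<le> chebP \<beta> L t * n 0 + (\<Sum>s<t. chebS \<beta> L (t - s) * L2_set (e s) J)"
      unfolding n_def using lamJ a1 a2 by (intro recessive_bound[OF b L, where lam = lam]) auto
    then have "n t * ?b t \<le> (chebP \<beta> L t * n 0 + (\<Sum>s<t. chebS \<beta> L (t - s) * L2_set (e s) J)) * ?b t"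
      using bpos[of t] by (intro mult_right_mono) auto
    also have "\<dots> = chebP \<beta> L t * (n 0 * ?b t) + (\<Sum>s<t. chebS \<beta> L (t - s) * (L2_set (e s) J * ?b t))"
      by (simp add: distrib_right sum_distrib_right mult.assoc)
    also have "\<dots> \<le> chebP \<beta> L t * (m t * w 0) + (\<Sum>s<t. chebS \<beta> L (t - s) * (m t * F s))"
    \<comment> \<open>The kernels are nonnegative, so the Duhamel formulas for \<open>n\<close> and
      for \<open>w\<close> can be compared term by term.\<close>
    proof (intro add_mono mult_left_mono sum_mono Sn)
      have "n 0 * ?b t \<le> h * m 0 * ?b t"
        using h bpos[of t] by (simp add: m_def n_def)
      also have "\<dots> \<le> h * m t"
        using growth(2)[of 0 t] h0 by (simp add: mult.assoc mult_left_mono)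
      also have "\<dots> \<le> m t * w 0" using growth(1)[of t] eps by (simp add: w_def algebra_simps)
      finally show "n 0 * ?b t \<le> m t * w 0" .
      show "0 \<le> chebP \<beta> L t" using cheb_mono(1)[of \<beta> L L t] b L by simp
    next
      fix s assume "s \<in> {..<t}"
      then have s: "s < t" by simp
      have "L2_set (e s) J * ?b s \<le> ?c * (m s + n s) * ?b s"
        using noiseJ[of s] bpos[of s] by (intro mult_right_mono) (auto simp: m_def n_def \<delta>_def)
      also have "\<dots> = ?c * (m s * ?b s + n s * ?b s)" by (simp add: algebra_simps)
      also have "\<dots> \<le> ?c * (m s * ?b s + m s * w s)"
        using less[OF s] c0 by (intro mult_left_mono add_left_mono) auto
      also have "\<dots> = m s * (?c * (?b s + w s))" by (simp add: algebra_simps)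
      also have "\<dots> \<le> m s * F s" using F growth(1)[of s] by (intro mult_left_mono) auto
      finally have 1: "L2_set (e s) J * ?b s \<le> m s * F s" .
      have F0: "F s \<ge> 0"
        unfolding F_def using h0 eps ord ppos[of s] bpos[of s] by (auto intro!: add_nonneg_nonneg mult_nonneg_nonneg)
      \<comment> \<open>Growth of the top part transports the bound from time \<open>s\<close> to
        time \<open>t\<close>; the common factor \<open>?b s\<close> then cancels.\<close>
      have "L2_set (e s) J * ?b t * ?b s \<le> m s * F s * ?b t"
        using mult_right_mono[OF 1, of "?b t"] bpos[of t] by (simp add: mult_ac)
      also have "\<dots> \<le> m t * F s * ?b s"
        using mult_right_mono[OF growth(2)[of s t] F0] s by (simp add: mult_ac)
      finally show "L2_set (e s) J * ?b t \<le> m t * F s" using bpos[of s] by simp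
    qed
    also have "\<dots> = m t * w t"
      by (subst w[of t]) (simp add: sum_distrib_left algebra_simps)
    finally show ?case .
  qed
  have "n t \<le> m t * w t / ?b t" using main[of t] bpos[of t] by (simp add: field_simps)
  also have "\<dots> = (h * (chebP \<beta> L' t / ?b t) + \<epsilon> / 14) * m t"
    using bpos[of t] by (simp add: w_def field_simps)
  finally show ?thesis by (simp add: m_def n_def L'_def \<mu>_def \<delta>_def)
qed

section \<open>Euclidean norm, operator norm and smallest singular value\<close>

lemma vnorm_L2_set: "vnorm v = L2_set (\<lambda>i. v $ i) {0..<dim_vec v}"
  by (simp add: vnorm_def L2_set_def scalar_prod_def power2_eq_square)

lemma vnorm_nonneg [simp]: "vnorm v \<ge> 0"
  by (simp add: vnorm_L2_set)

lemma vnorm_smult: "vnorm (c \<cdot>\<^sub>v v) = \<bar>c\<bar> * vnorm v"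
  unfolding vnorm_def by (simp add: real_sqrt_mult mult.assoc[symmetric])

lemma abs_scalar_prod_le: "dim_vec v = dim_vec w \<Longrightarrow> \<bar>v \<bullet> w\<bar> \<le> vnorm v * vnorm w"
  unfolding vnorm_L2_set scalar_prod_def
  by (rule order.trans[OF sum_abs]) (simp add: abs_mult L2_set_mult_ineq)

text \<open>A crude bound whose purpose is to make the set in \<open>norm2\<close> bounded above, so
  that its supremum really is an upper bound.\<close>

lemma vnorm_mult_mat_vec_bound:
  assumes "x \<in> carrier_vec (dim_col M)"
  shows "vnorm (M *\<^sub>v x) \<le> (\<Sum>i = 0..<dim_row M. vnorm (row M i)) * vnorm x"
proof -
  have "vnorm (M *\<^sub>v x) \<le> (\<Sum>i = 0..<dim_row M. \<bar>row M i \<bullet> x\<bar>)"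
    unfolding vnorm_L2_set using L2_set_le_sum_abs[of "\<lambda>i. (M *\<^sub>v x) $ i" "{0..<dim_row M}"] by simp
  also have "\<dots> \<le> (\<Sum>i = 0..<dim_row M. vnorm (row M i) * vnorm x)"
    using assms by (intro sum_mono abs_scalar_prod_le) auto
  finally show ?thesis by (simp add: sum_distrib_right)
qed

lemma normalize_vec:
  assumes "x \<in> carrier_vec (dim_col M)" "vnorm x > 0"
  obtains y where "y \<in> carrier_vec (dim_col M)" "vnorm y = 1"
    "vnorm (M *\<^sub>v x) = vnorm (M *\<^sub>v y) * vnorm x"
proof
  let ?y = "inverse (vnorm x) \<cdot>\<^sub>v x"
  show "?y \<in> carrier_vec (dim_col M)" using assms by simp
  show "vnorm ?y = 1" using assms by (simp add: vnorm_smult)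
  show "vnorm (M *\<^sub>v x) = vnorm (M *\<^sub>v ?y) * vnorm x"
    using assms by (simp add: mult_mat_vec[of M "dim_row M" "dim_col M"] vnorm_smult)
qed

lemma vnorm_mult_mat_vec_le_norm2:
  assumes x: "x \<in> carrier_vec (dim_col M)"
  shows "vnorm (M *\<^sub>v x) \<le> norm2 M * vnorm x"
proof (cases "vnorm x = 0")
  case True
  then show ?thesis using vnorm_mult_mat_vec_bound[OF x] by simp
next
  case False
  then have pos: "vnorm x > 0" using vnorm_nonneg[of x] by linarith
  from normalize_vec[OF x pos] obtain y where y: "y \<in> carrier_vec (dim_col M)" "vnorm y = 1"
    "vnorm (M *\<^sub>v x) = vnorm (M *\<^sub>v y) * vnorm x" .
  have "vnorm (M *\<^sub>v y) \<le> norm2 M"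
    unfolding norm2_def
  proof (rule cSup_upper)
    show "bdd_above {vnorm (M *\<^sub>v x) |x. x \<in> carrier_vec (dim_col M) \<and> vnorm x = 1}"
      using vnorm_mult_mat_vec_bound[of _ M] by (fastforce intro!: bdd_aboveI)
  qed (use y in blast)
  then show ?thesis unfolding y(3) by (rule mult_right_mono) simp
qed

lemma sigma_min_mult_vnorm_le:
  assumes x: "x \<in> carrier_vec (dim_col M)"
  shows "sigma_min M * vnorm x \<le> vnorm (M *\<^sub>v x)"
proof (cases "vnorm x = 0")
  case False
  then have pos: "vnorm x > 0" using vnorm_nonneg[of x] by linarith
  from normalize_vec[OF x pos] obtain y where y: "y \<in> carrier_vec (dim_col M)" "vnorm y = 1"
    "vnorm (M *\<^sub>v x) = vnorm (M *\<^sub>v y) * vnorm x" .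
  have "sigma_min M \<le> vnorm (M *\<^sub>v y)"
    unfolding sigma_min_def
  proof (rule cInf_lower)
    show "bdd_below {vnorm (M *\<^sub>v x) |x. x \<in> carrier_vec (dim_col M) \<and> vnorm x = 1}"
      by (rule bdd_belowI[of _ 0]) auto
  qed (use y in blast)
  then show ?thesis unfolding y(3) by (rule mult_right_mono) simp
qed simp

lemma vnorm_unit_vec: "i < n \<Longrightarrow> vnorm (unit_vec n i) = 1"
  by (simp add: vnorm_def)

lemma le_sigma_min:
  assumes "dim_col M > 0"
    and "\<And>x. x \<in> carrier_vec (dim_col M) \<Longrightarrow> vnorm x = 1 \<Longrightarrow> c \<le> vnorm (M *\<^sub>v x)"
  shows "c \<le> sigma_min M"
  unfolding sigma_min_def
proof (rule cInf_greatest)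
  show "{vnorm (M *\<^sub>v x) |x. x \<in> carrier_vec (dim_col M) \<and> vnorm x = 1} \<noteq> {}"
    using vnorm_unit_vec[OF assms(1)] unit_vec_carrier[of "dim_col M" 0] by blast
qed (use assms(2) in blast)

lemma sigma_min_le:
  assumes "dim_col M > 0"
    and "\<And>x. x \<in> carrier_vec (dim_col M) \<Longrightarrow> vnorm x = 1 \<Longrightarrow> vnorm (M *\<^sub>v x) \<le> c"
  shows "sigma_min M \<le> c"
  using sigma_min_mult_vnorm_le[of "unit_vec (dim_col M) 0" M] assms
    vnorm_unit_vec[of 0 "dim_col M"] by force

lemma smult_mult_mat_vec:
  "x \<in> carrier_vec (dim_col M) \<Longrightarrow> (c \<cdot>\<^sub>m M) *\<^sub>v x = c \<cdot>\<^sub>v (M *\<^sub>v x)" for M :: "real mat"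
  by (intro eq_vecI) auto

lemma vnorm_stiefel:
  assumes "X \<in> stiefel d k" "x \<in> carrier_vec k"
  shows "vnorm (X *\<^sub>v x) = vnorm x"
proof -
  have X: "X \<in> carrier_mat d k" "transpose_mat X * X = 1\<^sub>m k" using assms(1) by (auto simp: stiefel_def)
  have "(X *\<^sub>v x) \<bullet> (X *\<^sub>v x) = (transpose_mat X *\<^sub>v (X *\<^sub>v x)) \<bullet> x"
    by (rule transpose_vec_mult_scalar[OF X(1) assms(2), symmetric]) (use X assms in simp)
  also have "transpose_mat X *\<^sub>v (X *\<^sub>v x) = (transpose_mat X * X) *\<^sub>v x"
    using X assms(2) by (intro assoc_mult_mat_vec[symmetric]) auto
  finally show ?thesis using X assms(2) by (simp add: vnorm_def)
qed

section \<open>Coordinates in the eigenbasis and the largest principal angle\<close>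

locale orthonormal_frame =
  fixes d :: nat and u :: "nat \<Rightarrow> real vec"
  assumes u_carrier: "i \<in> {1..d} \<Longrightarrow> u i \<in> carrier_vec d"
    and u_orth: "i \<in> {1..d} \<Longrightarrow> j \<in> {1..d} \<Longrightarrow> u i \<bullet> u j = (if i = j then 1 else 0)"
begin

abbreviation coord :: "real vec \<Rightarrow> nat \<Rightarrow> real" where
  "coord z i \<equiv> u i \<bullet> z"

lemma vnorm_Utop:
  assumes "k \<le> d"
  shows "vnorm (transpose_mat (Utop d k u) *\<^sub>v z) = L2_set (coord z) {1..k}"
proof -
  have "col (Utop d k u) i = u (Suc i)" if "i < k" for i
    using that assms u_carrier[of "Suc i"] by (intro eq_vecI) (auto simp: Utop_def)
  then have "vnorm (transpose_mat (Utop d k u) *\<^sub>v z) = L2_set (\<lambda>i. coord z (Suc i)) {0..<k}"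
    unfolding vnorm_L2_set by (intro L2_set_cong) (auto simp: Utop_def)
  also have "\<dots> = L2_set (coord z) {1..k}"
    unfolding L2_set_def by (simp add: sum.atLeast1_atMost_eq lessThan_atLeast0)
  finally show ?thesis .
qed

lemma vnorm_Ubot:
  assumes "k \<le> d"
  shows "vnorm (transpose_mat (Ubot d k u) *\<^sub>v z) = L2_set (coord z) {k+1..d}"
proof -
  have "col (Ubot d k u) i = u (i + Suc k)" if "i < d - k" for i
  proof -
    have "u (i + Suc k) \<in> carrier_vec d" using that assms by (intro u_carrier) auto
    then show ?thesis using that by (intro eq_vecI) (auto simp: Ubot_def)
  qed
  then have "vnorm (transpose_mat (Ubot d k u) *\<^sub>v z) = L2_set (\<lambda>i. coord z (i + Suc k)) {0..<d - k}"
    unfolding vnorm_L2_set by (intro L2_set_cong) (auto simp: Ubot_def)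
  also have "\<dots> = L2_set (coord z) {0 + Suc k..<(d - k) + Suc k}"
    unfolding L2_set_def by (simp only: sum.shift_bounds_nat_ivl)
  also have "{0 + Suc k..<(d - k) + Suc k} = {k+1..d}" using assms by auto
  finally show ?thesis .
qed

lemma parseval:
  assumes z: "z \<in> carrier_vec d"
  shows "L2_set (coord z) {1..d} = vnorm z"
proof -
  let ?U = "Utop d d u"
  have U: "?U \<in> carrier_mat d d" by (simp add: Utop_def)
  have c: "col ?U i = u (Suc i)" if "i < d" for i
    using that u_carrier[of "Suc i"] by (intro eq_vecI) (auto simp: Utop_def)
  have "transpose_mat ?U * ?U = 1\<^sub>m d"
    using U by (intro eq_matI) (auto simp: c u_orth)
  \<comment> \<open>Orthonormality gives a left inverse; for square matrices it is also a right
    inverse, which is completeness of the frame.\<close>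
  from mat_mult_left_right_inverse[OF _ U this] U have I: "?U * transpose_mat ?U = 1\<^sub>m d" by simp
  have Uz: "transpose_mat ?U *\<^sub>v z \<in> carrier_vec d" using U z by simp
  have "(transpose_mat ?U *\<^sub>v z) \<bullet> (transpose_mat ?U *\<^sub>v z) = z \<bullet> (?U *\<^sub>v (transpose_mat ?U *\<^sub>v z))"
    by (rule transpose_vec_mult_scalar[OF U Uz z])
  also have "?U *\<^sub>v (transpose_mat ?U *\<^sub>v z) = (?U * transpose_mat ?U) *\<^sub>v z"
    using U z by (intro assoc_mult_mat_vec[symmetric]) auto
  finally have "vnorm (transpose_mat ?U *\<^sub>v z) = vnorm z" using z by (simp add: vnorm_def I)
  then show ?thesis by (simp add: vnorm_Utop)
qed

lemma vnorm_split:
  assumes z: "z \<in> carrier_vec d" and "k \<le> d"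
  shows "(vnorm z)\<^sup>2 = (L2_set (coord z) {1..k})\<^sup>2 + (L2_set (coord z) {k+1..d})\<^sup>2"
proof -
  have "{1..d} = {1..k} \<union> {k+1..d}" using assms(2) by auto
  then have "(\<Sum>i\<in>{1..d}. (coord z i)\<^sup>2) = (\<Sum>i\<in>{1..k}. (coord z i)\<^sup>2) + (\<Sum>i\<in>{k+1..d}. (coord z i)\<^sup>2)"
    by (simp add: sum.union_disjoint)
  then show ?thesis
    unfolding parseval[OF z, symmetric] L2_set_def by (simp add: sum_nonneg)
qed

text \<open>\<open>theta\<close> goes through \<open>arccos\<close>, so the cosine is recovered only
  once \<open>sigma_min\<close> is known to lie in \<open>[0, 1]\<close>. The upper bound holds
  since \<open>X\<close> is an isometry and the top coordinates carry only part of the norm.\<close>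

lemma cos_theta:
  assumes X: "X \<in> stiefel d k" and k: "1 \<le> k" "k \<le> d"
  shows "cos (theta (Utop d k u) X) = sigma_min (transpose_mat (Utop d k u) * X)"
    and "0 \<le> sigma_min (transpose_mat (Utop d k u) * X)"
    and "sigma_min (transpose_mat (Utop d k u) * X) \<le> 1"
    and "x \<in> carrier_vec k \<Longrightarrow>
      vnorm ((transpose_mat (Utop d k u) * X) *\<^sub>v x) = L2_set (coord (X *\<^sub>v x)) {1..k}"
proof -
  have Xc: "X \<in> carrier_mat d k" using X by (simp add: stiefel_def)
  have U: "transpose_mat (Utop d k u) \<in> carrier_mat k d" by (simp add: Utop_def)
  let ?M = "transpose_mat (Utop d k u) * X"
  have dim: "dim_col ?M = k" using Xc by simp
  show eq: "vnorm (?M *\<^sub>v x) = L2_set (coord (X *\<^sub>v x)) {1..k}" if "x \<in> carrier_vec k" for x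
    using vnorm_Utop[OF k(2), of "X *\<^sub>v x"] assoc_mult_mat_vec[OF U Xc that] by simp
  show 0: "0 \<le> sigma_min ?M" by (rule le_sigma_min) (use k dim in auto)
  show 1: "sigma_min ?M \<le> 1"
  proof (rule sigma_min_le)
    fix x assume x: "x \<in> carrier_vec (dim_col ?M)" "vnorm x = 1"
    then have "(vnorm (?M *\<^sub>v x))\<^sup>2 \<le> (vnorm (X *\<^sub>v x))\<^sup>2"
      using vnorm_split[of "X *\<^sub>v x" k] eq[of x] Xc k dim by auto
    then show "vnorm (?M *\<^sub>v x) \<le> 1"
      using vnorm_stiefel[OF X, of x] x dim by (simp add: abs_square_le_1)
  qed (use k dim in simp)
  show "cos (theta (Utop d k u) X) = sigma_min ?M"
    unfolding theta_def using 0 1 by (intro cos_arccos) auto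
qed

text \<open>With top norm \<open>m\<close> and bottom norm \<open>n\<close>, combine
  \<open>\<sigma> * vnorm x \<le> m\<close> with
  \<open>(vnorm x)\<^sup>2 = m\<^sup>2 + n\<^sup>2\<close> and solve for \<open>n\<close>.\<close>

lemma L2_set_bottom_le_tan:
  assumes X: "X \<in> stiefel d k" and k: "1 \<le> k" "k \<le> d"
    and pos: "cos (theta (Utop d k u) X) > 0" and x: "x \<in> carrier_vec k"
  shows "0 \<le> tan (theta (Utop d k u) X)"
    and "L2_set (coord (X *\<^sub>v x)) {k+1..d}
      \<le> tan (theta (Utop d k u) X) * L2_set (coord (X *\<^sub>v x)) {1..k}"
proof -
  let ?M = "transpose_mat (Utop d k u) * X"
  let ?m = "L2_set (coord (X *\<^sub>v x)) {1..k}" and ?n = "L2_set (coord (X *\<^sub>v x)) {k+1..d}"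
  define \<sigma> where "\<sigma> = sigma_min ?M"
  note c = cos_theta[OF X k, folded \<sigma>_def]
  have Xc: "X \<in> carrier_mat d k" using X by (simp add: stiefel_def)
  have s: "0 < \<sigma>" "\<sigma> \<le> 1" using pos c by auto
  have t: "tan (theta (Utop d k u) X) = sqrt (1 - \<sigma>\<^sup>2) / \<sigma>"
    unfolding theta_def \<sigma>_def[symmetric] using s by (simp add: tan_def sin_arccos cos_arccos)
  show "0 \<le> tan (theta (Utop d k u) X)" using s by (simp add: t power_le_one)
  have "\<sigma> * vnorm x \<le> ?m"
    using sigma_min_mult_vnorm_le[of x ?M] c(4)[OF x] Xc x by (simp add: \<sigma>_def)
  then have "\<sigma>\<^sup>2 * (vnorm x)\<^sup>2 \<le> ?m\<^sup>2"
    using power_mono[of "\<sigma> * vnorm x" ?m 2] s by (simp add: power_mult_distrib)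
  moreover have "(vnorm x)\<^sup>2 = ?m\<^sup>2 + ?n\<^sup>2"
    using vnorm_split[of "X *\<^sub>v x" k] vnorm_stiefel[OF X x] Xc x k by simp
  ultimately have "\<sigma>\<^sup>2 * ?n\<^sup>2 \<le> (1 - \<sigma>\<^sup>2) * ?m\<^sup>2" by (simp add: algebra_simps)
  then have "sqrt (\<sigma>\<^sup>2 * ?n\<^sup>2) \<le> sqrt ((1 - \<sigma>\<^sup>2) * ?m\<^sup>2)" by (rule real_sqrt_le_mono)
  then have "\<sigma> * ?n \<le> sqrt (1 - \<sigma>\<^sup>2) * ?m"
    using s by (simp add: real_sqrt_mult)
  then show "?n \<le> tan (theta (Utop d k u) X) * ?m"
    unfolding t using s by (simp add: field_simps)
qed

text \<open>For a unit vector \<open>m\<^sup>2 + n\<^sup>2 = 1\<close>, so \<open>m \<le> 1\<close>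
  and \<open>n \<le> \<epsilon> * m\<close> give
  \<open>m\<^sup>2 \<ge> 1 - \<epsilon>\<^sup>2\<close>, a lower bound on the cosine.\<close>

lemma sin_theta_le:
  assumes X: "X \<in> stiefel d k" and k: "1 \<le> k" "k \<le> d" and eps: "0 < \<epsilon>" "\<epsilon> < 1"
    and tan: "\<And>x. x \<in> carrier_vec k \<Longrightarrow> vnorm x = 1 \<Longrightarrow>
      L2_set (coord (X *\<^sub>v x)) {k+1..d} \<le> \<epsilon> * L2_set (coord (X *\<^sub>v x)) {1..k}"
  shows "sin (theta (Utop d k u) X) \<le> \<epsilon>"
proof -
  let ?M = "transpose_mat (Utop d k u) * X"
  have Xc: "X \<in> carrier_mat d k" using X by (simp add: stiefel_def)
  note c = cos_theta[OF X k]
  have "sqrt (1 - \<epsilon>\<^sup>2) \<le> sigma_min ?M"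
  proof (rule le_sigma_min)
    fix x assume "x \<in> carrier_vec (dim_col ?M)" and x1: "vnorm x = 1"
    then have x: "x \<in> carrier_vec k" using Xc by simp
    let ?m = "L2_set (coord (X *\<^sub>v x)) {1..k}" and ?n = "L2_set (coord (X *\<^sub>v x)) {k+1..d}"
    have "1 = ?m\<^sup>2 + ?n\<^sup>2"
      using vnorm_split[of "X *\<^sub>v x" k] vnorm_stiefel[OF X x] Xc x k x1 by simp
    moreover have "?n\<^sup>2 \<le> \<epsilon>\<^sup>2 * ?m\<^sup>2"
      using power_mono[OF tan[OF x x1], of 2] by (simp add: power_mult_distrib)
    moreover have "\<epsilon>\<^sup>2 * ?m\<^sup>2 \<le> \<epsilon>\<^sup>2 * 1"
      using calculation(1) zero_le_power2[of ?n] by (intro mult_left_mono) (linarith, simp)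
    ultimately have "1 - \<epsilon>\<^sup>2 \<le> ?m\<^sup>2" by linarith
    then have "sqrt (1 - \<epsilon>\<^sup>2) \<le> ?m" by (rule real_le_lsqrt[rotated -1]) simp
    then show "sqrt (1 - \<epsilon>\<^sup>2) \<le> vnorm (?M *\<^sub>v x)" by (simp add: c(4)[OF x])
  qed (use Xc k in simp)
  then have "(sqrt (1 - \<epsilon>\<^sup>2))\<^sup>2 \<le> (sigma_min ?M)\<^sup>2"
    using eps by (intro power_mono) (auto simp: power_le_one)
  then have "1 - (sigma_min ?M)\<^sup>2 \<le> \<epsilon>\<^sup>2" using eps by (simp add: power_le_one)
  then have "sqrt (1 - (sigma_min ?M)\<^sup>2) \<le> \<epsilon>" using eps by (simp add: real_le_lsqrt)
  then show ?thesis unfolding theta_def using c by (simp add: sin_arccos)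
qed

end

section \<open>Choice of the iteration count\<close>

lemma exists_iteration_count:
  fixes h \<rho> \<epsilon> :: real
  assumes r: "0 < \<rho>" "\<rho> \<le> 1" and h: "0 \<le> h" and eps: "0 < \<epsilon>"
  shows "\<exists>T. real T \<le> 6 * (1 / \<rho>) * max 1 (ln (h / \<epsilon>)) \<and>
    (\<forall>t\<ge>T. h * (2 * exp (- (7 / 16 * \<rho> * real t))) + \<epsilon> / 14 \<le> \<epsilon>)"
proof -
  define M where "M = max 1 (ln (h / \<epsilon>))"
  define B where "B = 16 / 7 * (1 / \<rho>) * (1 + M)"
  have M: "M \<ge> 1" "M \<ge> ln (h / \<epsilon>)" by (auto simp: M_def)
  have rM: "1 \<le> 1 / \<rho>" using r by simp
  have rM1: "1 \<le> 1 / \<rho> * M" using mult_mono[OF rM M(1)] r by simp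
  have B0: "B \<ge> 0" using r M by (simp add: B_def)
  have "real (nat \<lceil>B\<rceil>) \<le> B + 1" using B0 by linarith
  \<comment> \<open>\<open>1 + M\<close> is at most \<open>2 * M\<close>, and rounding up costs 1,
    at most \<open>1 / \<rho> * M\<close>. The total factor \<open>32 / 7 + 1\<close> is below
    6.\<close>
  also have "B + 1 \<le> 16 / 7 * (1 / \<rho>) * (2 * M) + 1 / \<rho> * M"
    unfolding B_def using M r rM1 by (intro add_mono mult_left_mono) auto
  also have "\<dots> \<le> 6 * (1 / \<rho>) * M" using rM1 by simp
  finally have T: "real (nat \<lceil>B\<rceil>) \<le> 6 * (1 / \<rho>) * M" .
  have "h * (2 * exp (- (7 / 16 * \<rho> * real t))) + \<epsilon> / 14 \<le> \<epsilon>" if t: "t \<ge> nat \<lceil>B\<rceil>" for t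
  \<comment> \<open>At \<open>h = 0\<close> the logarithm carries no information, but the
    exponential term vanishes.\<close>
  proof (cases "h = 0")
    case False
    with h have h: "h > 0" by simp
    have "B \<le> real t" using t by linarith
    then have "7 / 16 * \<rho> * B \<le> 7 / 16 * \<rho> * real t" using r by (intro mult_left_mono) auto
    moreover have "7 / 16 * \<rho> * B = 1 + M" using r by (simp add: B_def)
    ultimately have "1 + M \<le> 7 / 16 * \<rho> * real t" by (simp only:)
    with M(2) have "1 + ln (h / \<epsilon>) \<le> 7 / 16 * \<rho> * real t" by (rule order.trans[OF add_left_mono])
    then have "exp (- (7 / 16 * \<rho> * real t)) \<le> exp (- (1 + ln (h / \<epsilon>)))"
      by (simp only: exp_le_cancel_iff neg_le_iff_le)
    also have "\<dots> = \<epsilon> / h * inverse (exp 1)"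
      unfolding exp_minus exp_add using h eps by (simp add: field_simps)
    \<comment> \<open>The extra 1 in \<open>1 + M\<close> yields the factor
      \<open>1 / exp 1\<close>, at most \<open>2 / 5\<close>. The exponential term is thus at most
      \<open>4 / 5 * \<epsilon>\<close>, leaving room for \<open>\<epsilon> / 14\<close>.\<close>
    also have "\<dots> \<le> \<epsilon> / h * inverse (5 / 2)"
      using exp_lower_Taylor_quadratic[of 1] h eps by (intro mult_left_mono le_imp_inverse_le) auto
    finally have "h * (2 * exp (- (7 / 16 * \<rho> * real t))) \<le> h * (2 * (\<epsilon> / h * inverse (5 / 2)))"
      using h by (intro mult_left_mono) auto
    also have "\<dots> = 4 / 5 * \<epsilon>" using h by simp
    finally show ?thesis using eps by simp
  qed (use eps in simp)
  with T show ?thesis unfolding M_def by blast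
qed

section \<open>The ANPM iterates without normalisation, and their convergence\<close>

primrec R_prod :: "(nat \<Rightarrow> real mat) \<Rightarrow> real vec \<Rightarrow> nat \<Rightarrow> real vec" where
  "R_prod R \<xi> 0 = \<xi>"
| "R_prod R \<xi> (Suc t) = R (Suc t) *\<^sub>v R_prod R \<xi> t"

text \<open>Solve backwards, one invertible factor at a time. Bounds proved for all starting
  directions \<xi> then reach every unit vector at time \<open>t\<close>.\<close>

lemma R_prod_surj:
  assumes "\<And>t. R (Suc t) \<in> carrier_mat k k" "\<And>t. Rinv (Suc t) \<in> carrier_mat k k"
    "\<And>t. R (Suc t) * Rinv (Suc t) = 1\<^sub>m k" and "r \<in> carrier_vec k"
  shows "\<exists>\<xi>\<in>carrier_vec k. R_prod R \<xi> t = r"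
  using assms(4)
proof (induction t arbitrary: r)
  case (Suc t)
  then obtain \<xi> where \<xi>: "\<xi> \<in> carrier_vec k" "R_prod R \<xi> t = Rinv (Suc t) *\<^sub>v r"
    using Suc.IH[OF mult_mat_vec_carrier[OF assms(2) Suc.prems]] by blast
  have "R (Suc t) *\<^sub>v (Rinv (Suc t) *\<^sub>v r) = r"
    using assoc_mult_mat_vec[OF assms(1) assms(2) Suc.prems, of t t] assms(3)[of t] Suc.prems by simp
  with \<xi> show ?case by (intro bexI[of _ \<xi>]) simp_all
qed auto

text \<open>Conditions for \<open>t \<ge> 1\<close> are indexed by \<open>Suc t\<close>, so that the
  previous iterate is \<open>X t\<close> and no subtraction on naturals occurs.\<close>

locale anpm = orthonormal_frame d u for d :: nat and u :: "nat \<Rightarrow> real vec" +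
  fixes k :: nat and \<epsilon> \<beta> :: real and A :: "real mat" and lam :: "nat \<Rightarrow> real"
    and X R Rinv Y \<Xi> :: "nat \<Rightarrow> real mat"
  assumes k: "1 \<le> k" "k < d" and eps: "0 < \<epsilon>" "\<epsilon> < 1"
    and A: "A \<in> carrier_mat d d" "transpose_mat A = A"
    and lam_mono: "i \<in> {1..d} \<Longrightarrow> j \<in> {1..d} \<Longrightarrow> i \<le> j \<Longrightarrow> lam j \<le> lam i"
    and lam_nonneg: "0 \<le> lam d"
    and eigen: "i \<in> {1..d} \<Longrightarrow> A *\<^sub>v u i = lam i \<cdot>\<^sub>v u i"
    and gap: "lam (k + 1) < lam k"
    and X0: "X 0 \<in> stiefel d k" and cos0: "0 < cos (theta (Utop d k u) (X 0))"
    and \<beta>: "0 < \<beta>" "2 * sqrt \<beta> < lam (k + 1)"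
    and \<Xi>_carrier: "\<Xi> t \<in> carrier_mat d k"
    and Y1: "Y (Suc 0) = (1 / 2) \<cdot>\<^sub>m (A * X 0) + \<Xi> 0"
    and QR: "is_QR d k (Y (Suc t)) (X (Suc t)) (R (Suc t))"
    and R_Rinv: "R (Suc t) * Rinv (Suc t) = 1\<^sub>m k" "Rinv (Suc t) * R (Suc t) = 1\<^sub>m k"
    and Rinv_carrier: "Rinv (Suc t) \<in> carrier_mat k k"
    and Y_step: "Y (Suc (Suc t)) = A * X (Suc t) - \<beta> \<cdot>\<^sub>m (X t * Rinv (Suc t)) + \<Xi> (Suc t)"
    and noise_bot: "norm2 (transpose_mat (Ubot d k u) * \<Xi> t) \<le> 1 / 32 * (lam k - lam (k + 1)) * \<epsilon>"
    and noise_top: "norm2 (transpose_mat (Utop d k u) * \<Xi> t)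
      \<le> 1 / 32 * (lam k - lam (k + 1)) * cos (theta (Utop d k u) (X t))"
begin

lemma X_stiefel: "X t \<in> stiefel d k"
  using X0 QR[of "t - 1"] by (cases t) (auto simp: is_QR_def)

lemma X_carrier: "X t \<in> carrier_mat d k"
  using X_stiefel[of t] by (simp add: stiefel_def)

lemma R_carrier: "R (Suc t) \<in> carrier_mat k k"
  using QR[of t] by (simp add: is_QR_def)

lemma R_prod_carrier: "\<xi> \<in> carrier_vec k \<Longrightarrow> R_prod R \<xi> t \<in> carrier_vec k"
  by (induction t) (auto intro: mult_mat_vec_carrier[OF R_carrier])

lemma coord_A:
  assumes i: "i \<in> {1..d}" and z: "z \<in> carrier_vec d"
  shows "coord (A *\<^sub>v z) i = lam i * coord z i"
proof -
  have "coord (A *\<^sub>v z) i = (transpose_mat A *\<^sub>v u i) \<bullet> z"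
    by (rule transpose_vec_mult_scalar[OF A(1) z u_carrier[OF i], symmetric])
  also have "\<dots> = lam i * coord z i"
    using u_carrier[OF i] z by (simp add: A(2) eigen[OF i])
  finally show ?thesis .
qed

context
  fixes \<xi> :: "real vec"
  assumes \<xi>: "\<xi> \<in> carrier_vec k"
begin

definition r :: "nat \<Rightarrow> real vec" where "r = R_prod R \<xi>"
definition z :: "nat \<Rightarrow> real vec" where "z t = X t *\<^sub>v r t"
definition e :: "nat \<Rightarrow> real vec" where "e t = \<Xi> t *\<^sub>v r t"

lemma carriers: "r t \<in> carrier_vec k" "z t \<in> carrier_vec d" "e t \<in> carrier_vec d"
  using R_prod_carrier[OF \<xi>, of t] X_carrier[of t] \<Xi>_carrier[of t]
  by (auto simp: r_def z_def e_def)

lemma z_Suc: "z (Suc t) = Y (Suc t) *\<^sub>v r t"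
proof -
  have "Y (Suc t) = X (Suc t) * R (Suc t)" using QR[of t] by (simp add: is_QR_def)
  then show ?thesis
    using assoc_mult_mat_vec[OF X_carrier R_carrier carriers(1), of "Suc t" t t]
    by (simp add: z_def r_def)
qed

text \<open>Makes the momentum term \<open>X t * Rinv (Suc t)\<close>, applied to
  \<open>r (Suc t)\<close>, equal to \<open>z t\<close>, so the recursion for \<open>z\<close> is
  linear and free of QR factors.\<close>

lemma Rinv_r: "Rinv (Suc t) *\<^sub>v r (Suc t) = r t"
  using assoc_mult_mat_vec[OF Rinv_carrier R_carrier carriers(1), of t t t] R_Rinv(2)[of t] carriers(1)[of t]
  by (simp add: r_def)

lemma coord_z_1:
  assumes i: "i \<in> {1..d}"
  shows "coord (z (Suc 0)) i = lam i / 2 * coord (z 0) i + coord (e 0) i"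
proof -
  have AX: "A * X 0 \<in> carrier_mat d k" using A X_carrier by simp
  have "z (Suc 0) = (1 / 2) \<cdot>\<^sub>v (A *\<^sub>v z 0) + e 0"
    unfolding z_Suc Y1 unfolding z_def e_def
    using add_mult_distrib_mat_vec[OF smult_carrier_mat[OF AX] \<Xi>_carrier carriers(1), of "1 / 2" 0 0]
      assoc_mult_mat_vec[OF A(1) X_carrier carriers(1), of 0 0] smult_mult_mat_vec[of "r 0" "A * X 0"]
      AX carriers(1)[of 0] X_carrier[of 0] by simp
  moreover have Az: "A *\<^sub>v z 0 \<in> carrier_vec d" using A carriers by simp
  ultimately have "coord (z (Suc 0)) i = coord ((1 / 2) \<cdot>\<^sub>v (A *\<^sub>v z 0)) i + coord (e 0) i"
    using scalar_prod_add_distrib[OF u_carrier[OF i] _ carriers(3), of "(1 / 2) \<cdot>\<^sub>v (A *\<^sub>v z 0)"] by simp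
  also have "coord ((1 / 2) \<cdot>\<^sub>v (A *\<^sub>v z 0)) i = 1 / 2 * coord (A *\<^sub>v z 0) i"
    by (rule scalar_prod_smult_right) (use carrier_vecD[OF Az] carrier_vecD[OF u_carrier[OF i]] in simp)
  finally show ?thesis using coord_A[OF i carriers(2)] by simp
qed

lemma coord_z_step:
  assumes i: "i \<in> {1..d}"
  shows "coord (z (Suc (Suc t))) i = lam i * coord (z (Suc t)) i - \<beta> * coord (z t) i + coord (e (Suc t)) i"
proof -
  let ?r = "r (Suc t)"
  have AX: "A * X (Suc t) \<in> carrier_mat d k" and XR: "X t * Rinv (Suc t) \<in> carrier_mat d k"
    by (rule mult_carrier_mat[OF A(1) X_carrier], rule mult_carrier_mat[OF X_carrier Rinv_carrier])
  have "Y (Suc (Suc t)) *\<^sub>v ?r = (A * X (Suc t) - \<beta> \<cdot>\<^sub>m (X t * Rinv (Suc t))) *\<^sub>v ?r + e (Suc t)"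
    unfolding Y_step e_def
    by (rule add_mult_distrib_mat_vec[OF minus_carrier_mat[OF smult_carrier_mat[OF XR]] \<Xi>_carrier carriers(1)])
  also have "(A * X (Suc t) - \<beta> \<cdot>\<^sub>m (X t * Rinv (Suc t))) *\<^sub>v ?r
      = A *\<^sub>v z (Suc t) - \<beta> \<cdot>\<^sub>v z t"
    using minus_mult_distrib_mat_vec[OF AX smult_carrier_mat[OF XR] carriers(1), of \<beta> "Suc t"]
      assoc_mult_mat_vec[OF A(1) X_carrier carriers(1), of "Suc t" "Suc t"]
      smult_mult_mat_vec[of ?r "X t * Rinv (Suc t)" \<beta>] XR carriers(1)[of "Suc t"] Rinv_carrier[of t]
      assoc_mult_mat_vec[OF X_carrier Rinv_carrier carriers(1), of t t "Suc t"]
    by (simp add: Rinv_r z_def[symmetric])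
  finally have z: "z (Suc (Suc t)) = A *\<^sub>v z (Suc t) - \<beta> \<cdot>\<^sub>v z t + e (Suc t)"
    by (simp add: z_Suc)
  have Az: "A *\<^sub>v z (Suc t) \<in> carrier_vec d" and bz: "\<beta> \<cdot>\<^sub>v z t \<in> carrier_vec d"
    using A carriers by auto
  note u = u_carrier[OF i]
  have "coord (z (Suc (Suc t))) i = coord (A *\<^sub>v z (Suc t)) i - coord (\<beta> \<cdot>\<^sub>v z t) i + coord (e (Suc t)) i"
    using scalar_prod_add_distrib[OF u _ carriers(3), of "A *\<^sub>v z (Suc t) - \<beta> \<cdot>\<^sub>v z t"]
      scalar_prod_minus_distrib[OF u Az bz] Az bz by (simp add: z)
  also have "coord (\<beta> \<cdot>\<^sub>v z t) i = \<beta> * coord (z t) i"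
    by (rule scalar_prod_smult_right) (use carriers(2)[of t] u in auto)
  finally show ?thesis using coord_A[OF i carriers(2)] by simp
qed

text \<open>The cosine in the noise hypothesis is the smallest singular value of the top block of
  \<open>X t\<close>; times \<open>vnorm (r t)\<close> it is at most the top norm of
  \<open>z t\<close>, so the noise is relative to the signal.\<close>

lemma coord_noise_top:
  "L2_set (coord (e t)) {1..k} \<le> 1 / 32 * (lam k - lam (k + 1)) * L2_set (coord (z t)) {1..k}"
proof -
  let ?M = "transpose_mat (Utop d k u) * \<Xi> t"
  have U: "transpose_mat (Utop d k u) \<in> carrier_mat k d" by (simp add: Utop_def)
  note c = cos_theta[OF X_stiefel[of t] k(1) less_imp_le[OF k(2)]]
  have "L2_set (coord (e t)) {1..k} = vnorm (?M *\<^sub>v r t)"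
    using vnorm_Utop[of k "e t"] k assoc_mult_mat_vec[OF U \<Xi>_carrier carriers(1), of t t]
    by (simp add: e_def)
  also have "\<dots> \<le> norm2 ?M * vnorm (r t)"
    by (rule vnorm_mult_mat_vec_le_norm2) (use carriers(1)[of t] \<Xi>_carrier[of t] in simp)
  also have "\<dots> \<le> 1 / 32 * (lam k - lam (k + 1)) * cos (theta (Utop d k u) (X t)) * vnorm (r t)"
    by (intro mult_right_mono noise_top) simp
  also have "\<dots> = 1 / 32 * (lam k - lam (k + 1)) * (cos (theta (Utop d k u) (X t)) * vnorm (r t))"
    by (simp add: mult.assoc)
  also have "\<dots> \<le> 1 / 32 * (lam k - lam (k + 1)) * L2_set (coord (z t)) {1..k}"
    using sigma_min_mult_vnorm_le[of "r t" "transpose_mat (Utop d k u) * X t"] c(1) c(4)[OF carriers(1)]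
      X_carrier[of t] carriers(1)[of t] gap
    by (intro mult_left_mono) (auto simp: z_def)
  finally show ?thesis .
qed

text \<open>\<open>X t\<close> is an isometry, so \<open>vnorm (r t)\<close> is the norm of
  \<open>z t\<close>, at most the sum of its top and bottom parts.\<close>

lemma coord_noise_bot:
  "L2_set (coord (e t)) {k+1..d} \<le> 1 / 32 * (lam k - lam (k + 1)) * \<epsilon>
    * (L2_set (coord (z t)) {1..k} + L2_set (coord (z t)) {k+1..d})"
proof -
  let ?M = "transpose_mat (Ubot d k u) * \<Xi> t"
  let ?m = "L2_set (coord (z t)) {1..k}" and ?n = "L2_set (coord (z t)) {k+1..d}"
  have U: "transpose_mat (Ubot d k u) \<in> carrier_mat (d - k) d" by (simp add: Ubot_def)
  have "(vnorm (r t))\<^sup>2 = ?m\<^sup>2 + ?n\<^sup>2"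
    using vnorm_split[OF carriers(2), of k t] vnorm_stiefel[OF X_stiefel carriers(1), of t t] k
    by (simp add: z_def)
  also have "\<dots> \<le> (?m + ?n)\<^sup>2" by (simp add: power2_sum)
  finally have r: "vnorm (r t) \<le> ?m + ?n" by (rule power2_le_imp_le) simp
  have "L2_set (coord (e t)) {k+1..d} = vnorm (?M *\<^sub>v r t)"
    using vnorm_Ubot[of k "e t"] k assoc_mult_mat_vec[OF U \<Xi>_carrier carriers(1), of t t]
    by (simp add: e_def)
  also have "\<dots> \<le> norm2 ?M * vnorm (r t)"
    by (rule vnorm_mult_mat_vec_le_norm2) (use carriers(1)[of t] \<Xi>_carrier[of t] in simp)
  also have "\<dots> \<le> 1 / 32 * (lam k - lam (k + 1)) * \<epsilon> * vnorm (r t)"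
    by (intro mult_right_mono noise_bot) simp
  also have "\<dots> \<le> 1 / 32 * (lam k - lam (k + 1)) * \<epsilon> * (?m + ?n)"
    using gap eps r by (intro mult_left_mono) auto
  finally show ?thesis .
qed

lemma bottom_top_ratio:
  assumes nz: "vnorm \<xi> > 0"
  defines "\<rho> \<equiv> (plus_map \<beta> (lam k) - plus_map \<beta> (lam (k + 1))) / plus_map \<beta> (lam k)"
  shows "L2_set (coord (z t)) {k+1..d} \<le>
    (tan (theta (Utop d k u) (X 0)) * (2 * exp (- (7 / 16 * \<rho> * real t))) + \<epsilon> / 14) * L2_set (coord (z t)) {1..k}"
proof -
  let ?h = "tan (theta (Utop d k u) (X 0))"
  let ?q = "chebP \<beta> (lam (k+1) + (lam k - lam (k+1)) / 16) t / chebP \<beta> (lam k - (lam k - lam (k+1)) / 16) t"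
  note c = cos_theta[OF X0 k(1) less_imp_le[OF k(2)]]
  note h = L2_set_bottom_le_tan[OF X0 k(1) less_imp_le[OF k(2)] cos0 \<xi>]
  \<comment> \<open>A nonzero direction has a nonzero top part at time 0, because the initial cosine
    is positive.\<close>
  have "0 < sigma_min (transpose_mat (Utop d k u) * X 0) * vnorm \<xi>" using c cos0 nz by simp
  also have "\<dots> \<le> L2_set (coord (z 0)) {1..k}"
    using sigma_min_mult_vnorm_le[of \<xi> "transpose_mat (Utop d k u) * X 0"] c(4)[OF \<xi>] \<xi> X_carrier[of 0]
    by (simp add: z_def r_def)
  finally have pos: "0 < L2_set (coord (z 0)) {1..k}" .
  have "L2_set (coord (z t)) {k+1..d} \<le> (?h * ?q + \<epsilon> / 14) * L2_set (coord (z t)) {1..k}"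
  proof (rule recessive_dominant_ratio[where lam = lam and e = "\<lambda>t. coord (e t)" and a = "\<lambda>t. coord (z t)"])
    show "lam k \<le> lam i" if "i \<in> {1..k}" for i using that k lam_mono[of i k] by auto
    show "0 \<le> lam i \<and> lam i \<le> lam (k + 1)" if "i \<in> {k+1..d}" for i
      using that k lam_mono[of i d] lam_mono[of "k + 1" i] lam_nonneg by auto
    show "L2_set (coord (z 0)) {k+1..d} \<le> ?h * L2_set (coord (z 0)) {1..k}"
      using h(2) by (simp add: z_def r_def)
  qed (use \<beta> gap eps k h(1) pos coord_z_1 coord_z_step coord_noise_top coord_noise_bot in auto)
  also have "\<dots> \<le> (?h * (2 * exp (- (7 / 16 * \<rho> * real t))) + \<epsilon> / 14) * L2_set (coord (z t)) {1..k}"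
    unfolding \<rho>_def using cheb_ratio_le[of \<beta> "lam (k+1)" "lam k" t] \<beta> gap h(1)
    by (intro mult_right_mono add_right_mono mult_left_mono) auto
  finally show ?thesis .
qed

end

theorem convergence:
  "\<exists>T. real T \<le> 6 * (plus_map \<beta> (lam k) / (plus_map \<beta> (lam k) - plus_map \<beta> (lam (k + 1))))
        * max 1 (ln (tan (theta (Utop d k u) (X 0)) / \<epsilon>))
      \<and> (\<forall>t\<ge>T. sin (theta (Utop d k u) (X t)) \<le> \<epsilon>)"
proof -
  let ?p = "plus_map \<beta>" and ?h = "tan (theta (Utop d k u) (X 0))"
  define \<rho> where "\<rho> = (?p (lam k) - ?p (lam (k + 1))) / ?p (lam k)"
  have s: "0 < sqrt \<beta>" using \<beta> by simp
  have p0: "0 < ?p (lam (k + 1))" using plus_map_pos[of \<beta> "lam (k + 1)"] \<beta> s by simp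
  have "?p (lam (k + 1)) < ?p (lam k)"
  proof -
    have "(lam (k + 1))\<^sup>2 \<le> (lam k)\<^sup>2" using gap \<beta> s by (intro power_mono) linarith+
    then show ?thesis unfolding plus_map_def using gap by (intro divide_strict_right_mono add_less_le_mono) auto
  qed
  then have \<rho>: "0 < \<rho>" "\<rho> \<le> 1" using p0 by (auto simp: \<rho>_def)
  have h: "0 \<le> ?h"
    by (rule L2_set_bottom_le_tan(1)[OF X0 k(1) less_imp_le[OF k(2)] cos0 zero_carrier_vec])
  obtain T where T: "real T \<le> 6 * (1 / \<rho>) * max 1 (ln (?h / \<epsilon>))"
    "\<And>t. t \<ge> T \<Longrightarrow> ?h * (2 * exp (- (7 / 16 * \<rho> * real t))) + \<epsilon> / 14 \<le> \<epsilon>"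
    using exists_iteration_count[OF \<rho> h eps(1)] by blast
  have "sin (theta (Utop d k u) (X t)) \<le> \<epsilon>" if t: "t \<ge> T" for t
  proof (rule sin_theta_le[OF X_stiefel k(1) less_imp_le[OF k(2)] eps])
    fix x assume x: "x \<in> carrier_vec k" "vnorm x = 1"
    obtain \<xi> where \<xi>: "\<xi> \<in> carrier_vec k" "R_prod R \<xi> t = x"
      using R_prod_surj[where R = R and Rinv = Rinv, OF R_carrier Rinv_carrier R_Rinv(1) x(1)] by blast
    \<comment> \<open>A null \<xi> would stay null under all factors \<open>R\<close>, whereas
      \<open>x\<close> is a unit vector.\<close>
    have "vnorm \<xi> \<noteq> 0"
    proof
      assume "vnorm \<xi> = 0"
      then have "vnorm (R_prod R \<xi> s) = 0" for s
      proof (induction s)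
        case (Suc s)
        then show ?case
          using vnorm_mult_mat_vec_bound[of "R_prod R \<xi> s" "R (Suc s)"] R_prod_carrier[OF \<xi>(1), of s]
            R_carrier[of s] vnorm_nonneg[of "R (Suc s) *\<^sub>v R_prod R \<xi> s"] by simp
      qed simp
      then show False using \<xi>(2) x(2) by force
    qed
    then have nz: "vnorm \<xi> > 0" using vnorm_nonneg[of \<xi>] by linarith
    have "z \<xi> t = X t *\<^sub>v x" by (simp add: z_def[OF \<xi>(1)] r_def[OF \<xi>(1)] \<xi>(2))
    then have "L2_set (coord (X t *\<^sub>v x)) {k+1..d}
        \<le> (?h * (2 * exp (- (7 / 16 * \<rho> * real t))) + \<epsilon> / 14) * L2_set (coord (X t *\<^sub>v x)) {1..k}"
      using bottom_top_ratio[OF \<xi>(1) nz, of t] by (simp add: \<rho>_def)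
    also have "\<dots> \<le> \<epsilon> * L2_set (coord (X t *\<^sub>v x)) {1..k}"
      using T(2)[OF t] by (intro mult_right_mono) auto
    finally show "L2_set (coord (X t *\<^sub>v x)) {k+1..d} \<le> \<epsilon> * L2_set (coord (X t *\<^sub>v x)) {1..k}" .
  qed
  with T(1) show ?thesis by (auto simp: \<rho>_def)
qed

end

theorem theorem12:
  shows "\<exists>C::real. C > 0 \<and>
    (\<forall>(d::nat) (k::nat) (\<epsilon>::real) (A::real mat) (lam::nat \<Rightarrow> real) (u::nat \<Rightarrow> real vec)
       (\<beta>::real) (X::nat \<Rightarrow> real mat) (R::nat \<Rightarrow> real mat) (Rinv::nat \<Rightarrow> real mat)
       (Y::nat \<Rightarrow> real mat) (\<Xi>::nat \<Rightarrow> real mat).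
      d > k \<and> k \<ge> 1 \<and> 0 < \<epsilon> \<and> \<epsilon> < 1
      \<and> A \<in> carrier_mat d d \<and> transpose_mat A = A
      \<and> (\<forall>x \<in> carrier_vec d. x \<bullet> (A *\<^sub>v x) \<ge> 0)
      \<and> (\<forall>i\<in>{1..d}. \<forall>j\<in>{1..d}. i \<le> j \<longrightarrow> lam j \<le> lam i) \<and> lam d \<ge> 0
      \<and> (\<forall>i\<in>{1..d}. u i \<in> carrier_vec d \<and> A *\<^sub>v u i = lam i \<cdot>\<^sub>v u i)
      \<and> (\<forall>i\<in>{1..d}. \<forall>j\<in>{1..d}. u i \<bullet> u j = (if i = j then 1 else 0))
      \<and> lam k > lam (k+1)
      \<and> X 0 \<in> stiefel d k \<and> cos (theta (Utop d k u) (X 0)) > 0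
      \<and> \<beta> > 0 \<and> lam (k+1) > 2 * sqrt \<beta>
      \<and> (\<forall>t. \<Xi> t \<in> carrier_mat d k)
      \<and> Y 1 = (1/2) \<cdot>\<^sub>m (A * X 0) + \<Xi> 0
      \<and> (\<forall>t\<ge>1. is_QR d k (Y t) (X t) (R t))
      \<and> (\<forall>t\<ge>1. R t * Rinv t = 1\<^sub>m k \<and> Rinv t * R t = 1\<^sub>m k \<and> Rinv t \<in> carrier_mat k k)
      \<and> (\<forall>t\<ge>1. Y (t+1) = A * X t - \<beta> \<cdot>\<^sub>m (X (t-1) * Rinv t) + \<Xi> t)
      \<and> (\<forall>t. norm2 (transpose_mat (Ubot d k u) * \<Xi> t) \<le> (1/32) * (lam k - lam (k+1)) * \<epsilon>)
      \<and> (\<forall>t. norm2 (transpose_mat (Utop d k u) * \<Xi> t)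
              \<le> (1/32) * (lam k - lam (k+1)) * cos (theta (Utop d k u) (X t)))
      \<longrightarrow> (\<exists>T::nat. real T \<le> C * (plus_map \<beta> (lam k) / (plus_map \<beta> (lam k) - plus_map \<beta> (lam (k+1))))
                              * max 1 (ln (tan (theta (Utop d k u) (X 0)) / \<epsilon>))
            \<and> (\<forall>t\<ge>T. sin (theta (Utop d k u) (X t)) \<le> \<epsilon>)))"
proof (intro exI[of _ "6::real"] conjI allI impI, goal_cases)
  \<comment> \<open>The absolute constant 6 is the one produced by
    \<open>exists_iteration_count\<close>.\<close>
  case (2 d k \<epsilon> A lam u \<beta> X R Rinv Y \<Xi>)
  then have H: "d > k" "k \<ge> 1" "0 < \<epsilon>" "\<epsilon> < 1" "A \<in> carrier_mat d d" "transpose_mat A = A"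
    "\<forall>i\<in>{1..d}. \<forall>j\<in>{1..d}. i \<le> j \<longrightarrow> lam j \<le> lam i" "lam d \<ge> 0"
    "\<forall>i\<in>{1..d}. u i \<in> carrier_vec d \<and> A *\<^sub>v u i = lam i \<cdot>\<^sub>v u i"
    "\<forall>i\<in>{1..d}. \<forall>j\<in>{1..d}. u i \<bullet> u j = (if i = j then 1 else 0)"
    "lam k > lam (k+1)" "X 0 \<in> stiefel d k" "cos (theta (Utop d k u) (X 0)) > 0"
    "\<beta> > 0" "lam (k+1) > 2 * sqrt \<beta>" "\<forall>t. \<Xi> t \<in> carrier_mat d k"
    "Y 1 = (1/2) \<cdot>\<^sub>m (A * X 0) + \<Xi> 0" "\<forall>t\<ge>1. is_QR d k (Y t) (X t) (R t)"
    "\<forall>t\<ge>1. R t * Rinv t = 1\<^sub>m k \<and> Rinv t * R t = 1\<^sub>m k \<and> Rinv t \<in> carrier_mat k k"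
    "\<forall>t\<ge>1. Y (t+1) = A * X t - \<beta> \<cdot>\<^sub>m (X (t-1) * Rinv t) + \<Xi> t"
    "\<forall>t. norm2 (transpose_mat (Ubot d k u) * \<Xi> t) \<le> (1/32) * (lam k - lam (k+1)) * \<epsilon>"
    "\<forall>t. norm2 (transpose_mat (Utop d k u) * \<Xi> t)
      \<le> (1/32) * (lam k - lam (k+1)) * cos (theta (Utop d k u) (X t))"
    by blast+
  interpret orthonormal_frame d u
    by unfold_locales (use H(9,10) in blast)+
  interpret anpm d u k \<epsilon> \<beta> A lam X R Rinv Y \<Xi>
  proof unfold_locales
    show "Y (Suc 0) = (1 / 2) \<cdot>\<^sub>m (A * X 0) + \<Xi> 0" using H(17) by simp
    show "Y (Suc (Suc t)) = A * X (Suc t) - \<beta> \<cdot>\<^sub>m (X t * Rinv (Suc t)) + \<Xi> (Suc t)" for t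
      using H(20)[rule_format, of "Suc t"] by simp
    show "is_QR d k (Y (Suc t)) (X (Suc t)) (R (Suc t))" for t
      using H(18) by simp
    show "R (Suc t) * Rinv (Suc t) = 1\<^sub>m k" "Rinv (Suc t) * R (Suc t) = 1\<^sub>m k"
      "Rinv (Suc t) \<in> carrier_mat k k" for t
      using H(19) by simp_all
  qed (use H(1-16,21-22) in blast)+
  show ?case by (rule convergence)
qed simp

end
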